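(* Every 3-connected planar graph with minimum degree $5$ contains a $K_4$-model with at most $8$ vertices.
   Context: Graphs are finite, simple and undirected. A $K_t$-model in $G$ consists of $t$ pairwise vertex-disjoint connected subgraphs $B_1,\dots,B_t$ (branch sets) such that for all distinct $i,j$ some vertex of $B_i$ is adjacent to some vertex of $B_j$; its number of vertices is $\sum_i|B_i|$. *)

theory Defs
  imports "HOL-Analysis.Analysis" "Graph_Theory.Digraph_Component"
begin

text \<open>
  A finite simple undirected graph is a \<^locale>\<open>pair_graph\<close>: every undirected edge
  \<open>uv\<close> is represented by the two arcs \<open>(u, v)\<close> and \<open>(v, u)\<close>. In particular the degree
  of a vertex is its out-degree. The name \<open>connected\<close> also denotes topological
  connectedness, so graph connectedness is written in qualified form below; it
  excludes the graph without vertices.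
\<close>

definition edges :: "'a pair_pre_digraph \<Rightarrow> 'a set set" where
  "edges G = {{u, v} | u v. (u, v) \<in> parcs G}"

definition min_degree :: "'a pair_pre_digraph \<Rightarrow> nat" where
  "min_degree G = Min (out_degree (with_proj G) ` pverts G)"

definition k_connected :: "nat \<Rightarrow> 'a pair_pre_digraph \<Rightarrow> bool" where
  "k_connected k G \<longleftrightarrow> card (pverts G) > k \<and>
     (\<forall>X \<subseteq> pverts G. card X < k \<longrightarrow>
        Digraph_Component.connected (with_proj G \<restriction> (pverts G - X)))"

definition plane_embedding ::
  "'a pair_pre_digraph \<Rightarrow> ('a \<Rightarrow> complex) \<Rightarrow> ('a set \<Rightarrow> real \<Rightarrow> complex) \<Rightarrow> bool" where
  "plane_embedding G p \<gamma> \<longleftrightarrow>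
     inj_on p (pverts G) \<and>
     (\<forall>e \<in> edges G. arc (\<gamma> e) \<and> {pathstart (\<gamma> e), pathfinish (\<gamma> e)} = p ` e \<and>
        path_image (\<gamma> e) \<inter> p ` pverts G = p ` e) \<and>
     (\<forall>e \<in> edges G. \<forall>f \<in> edges G. e \<noteq> f \<longrightarrow>
        path_image (\<gamma> e) \<inter> path_image (\<gamma> f) \<subseteq> p ` (e \<inter> f))"

definition planar :: "'a pair_pre_digraph \<Rightarrow> bool" where
  "planar G \<longleftrightarrow> (\<exists>p \<gamma>. plane_embedding G p \<gamma>)"

text \<open>
  The library's \<open>subgraph\<close> also admits subgraphs containing only one of the two
  arcs of an edge; the condition \<open>pair_graph\<close> on the branch sets rules these out.
\<close>

definition complete_model ::
  "nat \<Rightarrow> 'a pair_pre_digraph \<Rightarrow> (nat \<Rightarrow> 'a pair_pre_digraph) \<Rightarrow> bool" where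
  "complete_model t G B \<longleftrightarrow>
     (\<forall>i<t. pair_graph (B i) \<and> subgraph (with_proj (B i)) (with_proj G) \<and>
        Digraph_Component.connected (with_proj (B i))) \<and>
     (\<forall>i<t. \<forall>j<t. i \<noteq> j \<longrightarrow>
        pverts (B i) \<inter> pverts (B j) = {} \<and>
        (\<exists>u \<in> pverts (B i). \<exists>v \<in> pverts (B j). (u, v) \<in> parcs G))"

definition model_order :: "nat \<Rightarrow> (nat \<Rightarrow> 'a pair_pre_digraph) \<Rightarrow> nat" where
  "model_order t B = (\<Sum>i<t. card (pverts (B i)))"

end

theory Submission
  imports Defs
begin

text \<open>
  A 2-connected plane graph is built from a cycle by adding ears. By the theta curve
  theorem every ear splits one face bounded by a cycle into two such faces, so one
  arrives at \<open>E - V + 2\<close> faces with every edge on exactly two of them. Give every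
  vertex \<open>v\<close> the charge \<open>1 - deg v / 2\<close> plus \<open>1 / length f\<close> for every face \<open>f\<close> at
  \<open>v\<close>. The total charge is 2, hence some vertex has positive charge; as all degrees are
  at least 5, it has degree 5, four of its faces are triangles and the fifth has length
  at most 5. The faces around this vertex span a wheel with at most 7 rim vertices,
  and cutting the rim into three segments that start at neighbours of the hub gives the
  model.
\<close>

subsection \<open>Theta curves\<close>

text \<open>Faces are not defined as components of the complement. A face is carried along as a
  vertex list and a region, which is the inside or the outside of the Jordan curve of that list, so
  the ear construction itself yields the incidence counts that discharging needs. The obstacle comes
  at the light vertex: the data say that each edge lies on two faces, but not in which cyclic order
  the faces follow each other. The faces there are therefore treated as the edges of a 2-regular
  multigraph on the five neighbours, and its disconnected shape is settled separately. The constant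
  8 is made up of the hub, its five neighbours and the at most two further vertices of a face of
  length 5.\<close>

text \<open>Going along \<open>c1\<close> and back along \<open>c2\<close> is a simple closed curve,
  so this is the Jordan curve theorem, in the form in which a cycle occurs once it is cut at two of
  its vertices.\<close>

lemma Jordan_two_arcs:
  fixes c1 c2 :: "real \<Rightarrow> complex"
  assumes "arc c1" "pathstart c1 = a" "pathfinish c1 = b"
    and "arc c2" "pathstart c2 = a" "pathfinish c2 = b"
    and "path_image c1 \<inter> path_image c2 = {a,b}"
    and "X = path_image c1 \<union> path_image c2"
  shows "inside X \<noteq> {}" "open (inside X)" "topological_space_class.connected (inside X)"
    "bounded (inside X)" "frontier (inside X) = X"
    "outside X \<noteq> {}" "open (outside X)" "topological_space_class.connected (outside X)"
    "frontier (outside X) = X" "compact X"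
proof -
  let ?g = "c1 +++ reversepath c2"
  have X: "path_image ?g = X"
    using assms by (simp add: path_image_join)
  have "simple_path ?g"
    using assms by (auto simp: simple_path_join_loop_eq arc_reversepath)
  moreover have "pathfinish ?g = pathstart ?g"
    using assms by simp
  ultimately show "inside X \<noteq> {}" "open (inside X)" "topological_space_class.connected (inside X)"
    "bounded (inside X)" "frontier (inside X) = X"
    "outside X \<noteq> {}" "open (outside X)" "topological_space_class.connected (outside X)"
    "frontier (outside X) = X" "compact X"
    using Jordan_inside_outside[of ?g] compact_simple_path_image[of ?g] unfolding X by auto
qed

text \<open>A connected set that meets \<open>inside X\<close> and also leaves it would have to
  cross the frontier, which is \<open>X\<close> itself.\<close>

lemma connected_inside_or_outside:
  fixes X :: "complex set"
  assumes "frontier (inside X) = X" "topological_space_class.connected K" "K \<inter> X = {}"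
  shows "K \<subseteq> inside X \<or> K \<subseteq> outside X"
proof -
  have "K \<inter> inside X = {} \<or> K \<subseteq> inside X"
    using connected_Int_frontier[of K "inside X"] assms by auto
  then show ?thesis
    using assms(3) inside_Un_outside[of X] by blast
qed

context
  fixes c1 c2 c :: "real \<Rightarrow> complex" and a b :: complex
  assumes c1: "arc c1" "pathstart c1 = a" "pathfinish c1 = b"
    and c2: "arc c2" "pathstart c2 = a" "pathfinish c2 = b"
    and c: "arc c" "pathstart c = a" "pathfinish c = b"
    and c12: "path_image c1 \<inter> path_image c2 = {a,b}"
    and c1c: "path_image c1 \<inter> path_image c = {a,b}"
    and c2c: "path_image c2 \<inter> path_image c = {a,b}"
begin

text \<open>Write X, Y, Z for the closed curves formed by \<open>c1\<close> and \<open>c2\<close>,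
  by \<open>c1\<close> and \<open>c\<close>, by \<open>c2\<close> and \<open>c\<close>. If both
  inclusions fail, the inside of X lies outside Y and outside Z, so a point in it is connected to a
  far point off Y and off Z. As Y and Z meet in the connected set \<open>path_image c\<close>,
  Janiszewski's theorem connects the points off the union of Y and Z. This union contains X, a
  contradiction.\<close>

lemma theta_inside_subset:
  assumes out: "path_image c - {a,b} \<subseteq> outside (path_image c1 \<union> path_image c2)"
  shows "inside (path_image c1 \<union> path_image c2) \<subseteq> inside (path_image c1 \<union> path_image c) \<or>
         inside (path_image c1 \<union> path_image c2) \<subseteq> inside (path_image c2 \<union> path_image c)"
proof (rule ccontr)
  let ?X = "path_image c1 \<union> path_image c2"
  let ?Y = "path_image c1 \<union> path_image c"
  let ?Z = "path_image c2 \<union> path_image c"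
  note X = Jordan_two_arcs[OF c1 c2 c12 refl]
  note Y = Jordan_two_arcs[OF c1 c c1c refl]
  note Z = Jordan_two_arcs[OF c2 c c2c refl]
  assume neg: "\<not> ?thesis"
  have ab: "a \<in> path_image c1" "b \<in> path_image c1" 
    using c12 by auto
  have disj: "inside ?X \<inter> ?X = {}"
    by (simp add: inside_no_overlap)
  have "inside ?X \<inter> path_image c = {}"
    using out inside_Int_outside[of ?X] disj ab by blast
  then have "inside ?X \<inter> ?Y = {}" "inside ?X \<inter> ?Z = {}"
    using disj by blast+
  then have sub: "inside ?X \<subseteq> outside ?Y" "inside ?X \<subseteq> outside ?Z"
    using neg connected_inside_or_outside[OF Y(5) X(3)] connected_inside_or_outside[OF Z(5) X(3)]
    by auto
  obtain x where x: "x \<in> inside ?X"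
    using X(1) by auto
  \<comment> \<open>The three closed curves and their insides form a bounded set, so some point lies
    outside all of them.\<close>
  have "bounded (inside ?X \<union> ?X \<union> (inside ?Y \<union> ?Y) \<union> (inside ?Z \<union> ?Z))"
    using X(4,10) Y(4,10) Z(4,10) by (metis bounded_Un compact_imp_bounded)
  then have "inside ?X \<union> ?X \<union> (inside ?Y \<union> ?Y) \<union> (inside ?Z \<union> ?Z) \<noteq> UNIV"
    using not_bounded_UNIV by metis
  then obtain y where y: "y \<in> outside ?X" "y \<in> outside ?Y" "y \<in> outside ?Z"
    unfolding outside_inside by blast
  have "connected_component (- ?Y) x y"
    unfolding connected_component_def
    using Y(8) sub x y outside_no_overlap[of ?Y] by blast
  moreover have "connected_component (- ?Z) x y"
    unfolding connected_component_def
    using Z(8) sub x y outside_no_overlap[of ?Z] by blast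
  moreover have "?Y \<inter> ?Z = path_image c"
    using c12 c1c c2c by auto
  then have "topological_space_class.connected (?Y \<inter> ?Z)"
    using c(1) connected_path_image arc_imp_path by metis
  ultimately have "connected_component (- (?Y \<union> ?Z)) x y"
    using Janiszewski Y(10) Z(10) compact_imp_closed by blast
  then obtain T where T: "topological_space_class.connected T" "T \<subseteq> - (?Y \<union> ?Z)" "x \<in> T" "y \<in> T"
    unfolding connected_component_def by blast
  have "T \<subseteq> inside ?X \<or> T \<subseteq> outside ?X"
    using T by (intro connected_inside_or_outside[OF X(5)]) auto
  then show False
    using T x y inside_Int_outside[of ?X] by blast
qed

text \<open>Reduction to an arc inside a curve: for the curve of \<open>c1\<close> and
  \<open>c\<close> it is \<open>c2\<close> that runs through the inside and splits it. Passing to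
  complements gives the claim.\<close>

lemma theta_outside_split:
  assumes out: "path_image c - {a,b} \<subseteq> outside (path_image c1 \<union> path_image c2)"
    and sub: "inside (path_image c1 \<union> path_image c2) \<subseteq> inside (path_image c1 \<union> path_image c)"
  shows "outside (path_image c1 \<union> path_image c) \<inter> inside (path_image c2 \<union> path_image c) = {}"
    "outside (path_image c1 \<union> path_image c) \<union> inside (path_image c2 \<union> path_image c) \<union>
       (path_image c - {a,b}) = outside (path_image c1 \<union> path_image c2)"
proof -
  let ?X = "path_image c1 \<union> path_image c2"
  let ?Y = "path_image c1 \<union> path_image c"
  let ?Z = "path_image c2 \<union> path_image c"
  note X = Jordan_two_arcs[OF c1 c2 c12 refl]
  note Y = Jordan_two_arcs[OF c1 c c1c refl]
  have ab: "a \<noteq> b"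
    using c1 arc_distinct_ends by blast
  \<comment> \<open>The arc \<open>c2\<close> lies on the frontier of the inside of
    \<open>?X\<close>, hence in the closure of the inside of \<open>?Y\<close>, and it meets
    \<open>?Y\<close> only in its ends.\<close>
  have "path_image c2 \<subseteq> closure (inside ?X)"
    using X(5) by (auto simp: closure_Un_frontier)
  also have "\<dots> \<subseteq> closure (inside ?Y)"
    using sub by (rule closure_mono)
  also have "\<dots> = inside ?Y \<union> ?Y"
    using Y(5) by (simp add: closure_Un_frontier)
  finally have "path_image c2 - {a,b} \<subseteq> inside ?Y"
    using c12 c2c by blast
  moreover have "path_image c2 - {a,b} \<noteq> {}"
    using nonempty_simple_path_endless[OF arc_imp_simple_path[OF c2(1)]] c2 by simp
  ultimately have "path_image c2 \<inter> inside ?Y \<noteq> {}"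
    by blast
  then have *: "inside ?X \<inter> inside (path_image c \<union> path_image c2) = {}"
     "inside ?X \<union> inside (path_image c \<union> path_image c2) \<union> (path_image c2 - {a,b}) = inside ?Y"
    using split_inside_simple_closed_curve[of c1 a b c c2] c1 c c2 ab c12 c1c c2c
    by (auto simp: arc_imp_simple_path Int_commute)
  have Z: "path_image c \<union> path_image c2 = ?Z"
    by auto
  show "outside ?Y \<inter> inside ?Z = {}"
    using * inside_Int_outside[of ?Y] unfolding Z by blast
  have "inside ?Z \<inter> ?Z = {}"
    by (simp add: inside_no_overlap)
  moreover have "inside ?Z \<inter> ?Y = {}"
    using *(2) inside_no_overlap[of ?Y] unfolding Z by blast
  ultimately have 1: "inside ?Z \<subseteq> outside ?X"
    using *(1) unfolding Z outside_inside by blast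
  have ab2: "a \<in> path_image c1" "b \<in> path_image c1" 
    using c12 by auto
  have 2: "outside ?Y \<subseteq> outside ?X"
  proof
    fix x assume "x \<in> outside ?Y"
    then have "x \<notin> inside ?Y" "x \<notin> ?Y"
      by (auto simp: outside_inside)
    then show "x \<in> outside ?X"
      using *(2) ab2 unfolding outside_inside by blast
  qed
  have 3: "outside ?X \<subseteq> outside ?Y \<union> inside ?Z \<union> (path_image c - {a,b})"
  proof
    fix x assume "x \<in> outside ?X"
    then have "x \<notin> inside ?X" "x \<notin> ?X"
      by (auto simp: outside_inside)
    then show "x \<in> outside ?Y \<union> inside ?Z \<union> (path_image c - {a,b})"
      using *(2) ab2 unfolding outside_inside Z by blast
  qed
  show "outside ?Y \<union> inside ?Z \<union> (path_image c - {a,b}) = outside ?X"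
    using 1 2 3 out by blast
qed

end

text \<open>Bounded and unbounded faces are treated alike. If \<open>R\<close> is an inside, both
  new regions are insides. If it is an outside, one is an inside and the other an outside, and
  \<open>theta_inside_subset\<close> decides which; hence the conclusion offers two candidates for
  each region.\<close>

lemma theta_split:
  fixes c1 c2 c :: "real \<Rightarrow> complex"
  assumes c1: "arc c1" "pathstart c1 = a" "pathfinish c1 = b"
    and c2: "arc c2" "pathstart c2 = a" "pathfinish c2 = b"
    and c: "arc c" "pathstart c = a" "pathfinish c = b"
    and c12: "path_image c1 \<inter> path_image c2 = {a,b}"
    and c1c: "path_image c1 \<inter> path_image c = {a,b}"
    and c2c: "path_image c2 \<inter> path_image c = {a,b}"
    and R: "R \<in> {inside (path_image c1 \<union> path_image c2), outside (path_image c1 \<union> path_image c2)}"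
    and sub: "path_image c - {a,b} \<subseteq> R"
  obtains R1 R2 where
    "R1 \<in> {inside (path_image c1 \<union> path_image c), outside (path_image c1 \<union> path_image c)}"
    "R2 \<in> {inside (path_image c2 \<union> path_image c), outside (path_image c2 \<union> path_image c)}"
    "R1 \<inter> R2 = {}" "R1 \<union> R2 \<union> (path_image c - {a,b}) = R"
proof (cases "R = inside (path_image c1 \<union> path_image c2)")
  case True
  have "path_image c - {a,b} \<noteq> {}"
    using nonempty_simple_path_endless[OF arc_imp_simple_path[OF c(1)]] c by simp
  then have "path_image c \<inter> inside (path_image c1 \<union> path_image c2) \<noteq> {}"
    using sub True by blast
  moreover have "a \<noteq> b"
    using c1 arc_distinct_ends by blast
  ultimately have "inside (path_image c1 \<union> path_image c) \<inter> inside (path_image c2 \<union> path_image c) = {}"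
    "inside (path_image c1 \<union> path_image c) \<union> inside (path_image c2 \<union> path_image c) \<union>
       (path_image c - {a,b}) = R"
    using split_inside_simple_closed_curve[of c1 a b c2 c] c1 c c2 c12 c1c c2c True
    by (auto simp: arc_imp_simple_path)
  then show ?thesis
    using that by blast
next
  case False
  then have R: "R = outside (path_image c1 \<union> path_image c2)"
    using R by auto
  from theta_inside_subset[OF c1 c2 c c12 c1c c2c sub[unfolded R]] show ?thesis
  proof
    assume *: "inside (path_image c1 \<union> path_image c2) \<subseteq> inside (path_image c1 \<union> path_image c)"
    from theta_outside_split[OF c1 c2 c c12 c1c c2c sub[unfolded R] *]
    show ?thesis
      using that R by blast
  next
    assume *: "inside (path_image c1 \<union> path_image c2) \<subseteq> inside (path_image c2 \<union> path_image c)"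
    have **: "path_image c2 \<union> path_image c1 = path_image c1 \<union> path_image c2"
      "path_image c2 \<inter> path_image c1 = {a,b}"
      using c12 by auto
    from theta_outside_split[OF c2 c1 c **(2) c2c c1c, unfolded **(1), OF sub[unfolded R] *]
    show ?thesis
      using that[of "inside (path_image c1 \<union> path_image c)" "outside (path_image c2 \<union> path_image c)"] R
      by (simp add: Int_commute Un_commute)
  qed
qed

subsection \<open>Edge sets of paths and cycles\<close>

fun path_edges :: "'a list \<Rightarrow> 'a set set" where
  "path_edges [] = {}"
| "path_edges [x] = {}"
| "path_edges (x # y # zs) = insert {x, y} (path_edges (y # zs))"

text \<open>This represents a cycle only for at least three distinct entries: with two, the closing
  edge is the path edge again, and with one it is a singleton.\<close>

definition cycle_edges :: "'a list \<Rightarrow> 'a set set" where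
  "cycle_edges xs = path_edges (xs @ [hd xs])"

lemma path_edges_append: "path_edges (l @ x # r) = path_edges (l @ [x]) \<union> path_edges (x # r)"
  by (induction l rule: path_edges.induct) auto

lemma path_edges_Cons: "ys \<noteq> [] \<Longrightarrow> path_edges (x # ys) = insert {x, hd ys} (path_edges ys)"
  by (cases ys) auto

lemma path_edges_snoc: "ys \<noteq> [] \<Longrightarrow> path_edges (ys @ [x]) = insert {last ys, x} (path_edges ys)"
  by (induction ys rule: path_edges.induct) auto

lemma path_edges_rev: "path_edges (rev xs) = path_edges xs"
proof (induction xs)
  case (Cons x xs)
  then show ?case
    by (cases "xs = []") (auto simp: path_edges_snoc path_edges_Cons last_rev insert_commute)
qed simp

lemma path_edges_subset: "e \<in> path_edges xs \<Longrightarrow> e \<subseteq> set xs"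
  by (induction xs rule: path_edges.induct) auto

lemma Union_path_edges: "2 \<le> length xs \<Longrightarrow> \<Union> (path_edges xs) = set xs"
proof (induction xs rule: path_edges.induct)
  case (3 x y zs)
  then show ?case by (cases zs) auto
qed auto

lemma finite_path_edges [simp]: "finite (path_edges xs)"
  by (induction xs rule: path_edges.induct) auto

lemma card_path_edges: "distinct xs \<Longrightarrow> card (path_edges xs) = length xs - 1"
proof (induction xs rule: path_edges.induct)
  case (3 x y zs)
  then have "{x, y} \<notin> path_edges (y # zs)"
    using path_edges_subset[of "{x, y}" "y # zs"] by auto
  then show ?case using 3 by simp
qed auto

text \<open>Only the first edge contains \<open>a\<close>, and its other end is \<open>b\<close>
  only if nothing lies between. This separates a path from a single edge with the same ends.\<close>

lemma end_edge_of_path: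
  assumes "distinct (a # l @ [b])" "{a, b} \<in> path_edges (a # l @ [b])"
  shows "l = []"
proof (cases l)
  case (Cons y k)
  have "{a, b} \<notin> path_edges (y # k @ [b])"
    using path_edges_subset[of "{a, b}" "y # k @ [b]"] assms(1) Cons by auto
  moreover have "{a, b} \<noteq> {a, y}"
    using assms(1) Cons by (auto simp: doubleton_eq_iff)
  ultimately show ?thesis
    using assms(2) Cons by simp
qed simp

lemma card_path_edge: "distinct xs \<Longrightarrow> e \<in> path_edges xs \<Longrightarrow> card e = 2"
  by (induction xs rule: path_edges.induct) auto

text \<open>A common edge consists of the common vertices \<open>a\<close> and \<open>b\<close>, and
  each path contains \<open>{a, b}\<close> only if it is that single edge.\<close>

lemma path_edges_disjoint:
  assumes "distinct (a # l @ [b])" "distinct (a # r @ [b])" "set l \<inter> set r = {}" "l \<noteq> [] \<or> r \<noteq> []"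
  shows "path_edges (a # l @ [b]) \<inter> path_edges (a # r @ [b]) = {}"
proof (rule ccontr)
  assume "\<not> ?thesis"
  then obtain e where e: "e \<in> path_edges (a # l @ [b])" "e \<in> path_edges (a # r @ [b])"
    by auto
  then have "e \<subseteq> {a, b}"
    using path_edges_subset[OF e(1)] path_edges_subset[OF e(2)] assms by auto
  moreover have "card e = 2"
    using card_path_edge e assms by blast
  moreover have "a \<noteq> b"
    using assms by auto
  ultimately have "e = {a, b}"
    by (intro card_subset_eq) auto
  then show False
    using end_edge_of_path[of a l b] end_edge_of_path[of a r b] e assms by blast
qed

text \<open>The second half is reversed so that both paths run from \<open>a\<close> to
  \<open>b\<close>, as the arcs of a theta curve must.\<close>

lemma cycle_edges_split:
  "cycle_edges (a # l @ b # r) = path_edges (a # l @ [b]) \<union> path_edges (a # rev r @ [b])"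
proof -
  have "path_edges (a # rev r @ [b]) = path_edges (b # r @ [a])"
    using path_edges_rev[of "b # r @ [a]"] by simp
  then show ?thesis
    using path_edges_append[of "a # l" b "r @ [a]"] by (simp add: cycle_edges_def)
qed

lemma cycle_edges_rotate: "cycle_edges (l @ r) = cycle_edges (r @ l)"
proof (cases "l = [] \<or> r = []")
  case False
  then obtain a l' b r' where "l = a # l'" "r = b # r'"
    by (meson list.exhaust)
  then show ?thesis
    using path_edges_append[of "a # l'" b "r' @ [a]"] path_edges_append[of "b # r'" a "l' @ [b]"]
    by (auto simp: cycle_edges_def)
qed auto

lemma cycle_list_from:
  assumes "v \<in> set xs" "distinct xs"
  obtains ys where "cycle_edges (v # ys) = cycle_edges xs" "distinct (v # ys)"
    "set (v # ys) = set xs" "length (v # ys) = length xs"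
proof -
  obtain l r where "xs = l @ v # r"
    using assms(1) by (meson split_list)
  then show ?thesis
    using that[of "r @ l"] cycle_edges_rotate[of l "v # r"] assms(2) by auto
qed

lemma cycle_list_split:
  assumes "3 \<le> length xs" "distinct xs"
  obtains a l b where "xs = a # l @ [b]" "l \<noteq> []"
proof -
  obtain a ys where xs: "xs = a # ys"
    using assms by (cases xs) auto
  then obtain l b where "ys = l @ [b]"
    using assms by (cases ys rule: rev_cases) auto
  then show ?thesis
    using that[of a l b] xs assms by fastforce
qed

lemma Union_cycle_edges: "2 \<le> length xs \<Longrightarrow> \<Union> (cycle_edges xs) = set xs"
  using Union_path_edges[of "xs @ [hd xs]"] by (cases xs) (auto simp: cycle_edges_def)

lemma finite_cycle_edges [simp]: "finite (cycle_edges xs)"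
  by (simp add: cycle_edges_def)

lemma card_cycle_edges:
  assumes "3 \<le> length xs" "distinct xs"
  shows "card (cycle_edges xs) = length xs"
proof -
  obtain a l b where xs: "xs = a # l @ [b]" "l \<noteq> []"
    using cycle_list_split[OF assms] .
  have "cycle_edges xs = insert {a, b} (path_edges xs)"
    using cycle_edges_split[of a l b "[]"] xs by auto
  moreover have "{a, b} \<notin> path_edges xs"
    using end_edge_of_path[of a l b] xs assms(2) by metis
  ultimately show ?thesis
    using card_path_edges[OF assms(2)] xs by simp
qed

lemma cycle_edges_at:
  assumes "distinct (v # ys)" "2 \<le> length ys"
  shows "{e \<in> cycle_edges (v # ys). v \<in> e} = {{v, hd ys}, {v, last ys}}"
proof -
  have "cycle_edges (v # ys) = insert {v, hd ys} (insert {v, last ys} (path_edges ys))"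
    using assms(2) by (cases ys)
      (auto simp: cycle_edges_def path_edges_Cons path_edges_snoc insert_commute)
  moreover have "v \<notin> e" if "e \<in> path_edges ys" for e
    using path_edges_subset[OF that] assms by auto
  ultimately show ?thesis by auto
qed

subsection \<open>Face systems of plane graphs\<close>

text \<open>The graph is reduced to its edge set, with \<open>\<Union>E\<close> as vertex set, so
  that the stages of an ear decomposition are subsets of \<open>E\<close> drawn by the same
  \<open>p\<close> and \<open>\<gamma>\<close>.\<close>

locale plane_graph =
  fixes E :: "'a set set" and p :: "'a \<Rightarrow> complex" and \<gamma> :: "'a set \<Rightarrow> real \<Rightarrow> complex"
  assumes finite_E: "finite E"
    and card_edge: "e \<in> E \<Longrightarrow> card e = 2"
    and inj_p: "inj_on p (\<Union>E)"
    and arc_edge: "e \<in> E \<Longrightarrow> arc (\<gamma> e)"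
    and ends_edge: "e \<in> E \<Longrightarrow> {pathstart (\<gamma> e), pathfinish (\<gamma> e)} = p ` e"
    and vertices_on_edge: "e \<in> E \<Longrightarrow> path_image (\<gamma> e) \<inter> p ` \<Union>E = p ` e"
    and crossing: "e \<in> E \<Longrightarrow> f \<in> E \<Longrightarrow> e \<noteq> f \<Longrightarrow> path_image (\<gamma> e) \<inter> path_image (\<gamma> f) \<subseteq> p ` (e \<inter> f)"
begin

definition drawing :: "'a set set \<Rightarrow> complex set" where
  "drawing D = (\<Union>e\<in>D. path_image (\<gamma> e))"

lemma drawing_Un: "drawing (A \<union> B) = drawing A \<union> drawing B"
  by (auto simp: drawing_def)

lemma drawing_mono: "A \<subseteq> B \<Longrightarrow> drawing A \<subseteq> drawing B"
  by (auto simp: drawing_def)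

lemma drawing_Int:
  assumes "A \<subseteq> E" "B \<subseteq> E" "A \<inter> B = {}"
  shows "drawing A \<inter> drawing B \<subseteq> p ` (\<Union>A \<inter> \<Union>B)"
proof
  fix z assume "z \<in> drawing A \<inter> drawing B"
  then obtain e f where "e \<in> A" "f \<in> B" "z \<in> path_image (\<gamma> e) \<inter> path_image (\<gamma> f)"
    by (auto simp: drawing_def)
  moreover from this have "z \<in> p ` (e \<inter> f)"
    using crossing[of e f] assms by blast
  ultimately show "z \<in> p ` (\<Union>A \<inter> \<Union>B)"
    by blast
qed

lemma vertex_in_drawing_iff:
  assumes "A \<subseteq> E" "x \<in> \<Union>E"
  shows "p x \<in> drawing A \<longleftrightarrow> x \<in> \<Union>A"
proof
  assume "p x \<in> drawing A"
  then obtain e where e: "e \<in> A" "p x \<in> path_image (\<gamma> e)"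
    by (auto simp: drawing_def)
  then have "p x \<in> p ` e"
    using vertices_on_edge[of e] assms by blast
  then have "x \<in> e"
    using inj_onD[OF inj_p] assms e by blast
  then show "x \<in> \<Union>A"
    using e by blast
next
  assume "x \<in> \<Union>A"
  then obtain e where e: "e \<in> A" "x \<in> e"
    by blast
  then have "p x \<in> path_image (\<gamma> e)"
    using vertices_on_edge[of e] assms by blast
  then show "p x \<in> drawing A"
    using e by (auto simp: drawing_def)
qed

text \<open>\<open>\<gamma>\<close> is indexed by unordered pairs, so its arc may run either way and
  is reversed if necessary.\<close>

lemma edge_arc:
  assumes "{x, y} \<in> E"
  obtains g where "arc g" "path_image g = path_image (\<gamma> {x, y})" "pathstart g = p x" "pathfinish g = p y"
proof (cases "pathstart (\<gamma> {x, y}) = p x")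
  case True
  then have "pathfinish (\<gamma> {x, y}) = p y"
    using ends_edge[OF assms] arc_distinct_ends[OF arc_edge[OF assms]] by (auto simp: doubleton_eq_iff)
  then show ?thesis
    using that True arc_edge[OF assms] by blast
next
  case False
  then have "pathstart (\<gamma> {x, y}) = p y" "pathfinish (\<gamma> {x, y}) = p x"
    using ends_edge[OF assms] by (auto simp: doubleton_eq_iff)
  then show ?thesis
    using that[of "reversepath (\<gamma> {x, y})"] arc_edge[OF assms] by (simp add: arc_reversepath)
qed

lemma path_arc:
  assumes "distinct xs" "2 \<le> length xs" "path_edges xs \<subseteq> E"
  shows "\<exists>g. arc g \<and> path_image g = drawing (path_edges xs) \<and>
           pathstart g = p (hd xs) \<and> pathfinish g = p (last xs)"
  using assms
proof (induction xs rule: path_edges.induct)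
  case (3 x y zs)
  obtain g where g: "arc g" "path_image g = path_image (\<gamma> {x, y})" "pathstart g = p x" "pathfinish g = p y"
    using edge_arc[of x y] 3 by auto
  show ?case
  proof (cases "zs = []")
    case True
    then show ?thesis
      using g by (intro exI[of _ g]) (auto simp: drawing_def)
  next
    case False
    then have len: "2 \<le> length (y # zs)"
      by (cases zs) auto
    then obtain h where h: "arc h" "path_image h = drawing (path_edges (y # zs))"
      "pathstart h = p y" "pathfinish h = p (last (y # zs))"
      using 3 by auto
    have "{x, y} \<notin> path_edges (y # zs)"
      using path_edges_subset[of "{x, y}" "y # zs"] 3 by auto
    then have "drawing {{x, y}} \<inter> drawing (path_edges (y # zs)) \<subseteq>
        p ` (\<Union>{{x, y}} \<inter> \<Union>(path_edges (y # zs)))"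
      using 3 by (intro drawing_Int) auto
    also have "\<dots> \<subseteq> {p y}"
      using Union_path_edges[OF len] 3 by auto
    finally have "path_image g \<inter> path_image h \<subseteq> {pathstart h}"
      using g h by (simp add: drawing_def)
    then have "arc (g +++ h)"
      using g h by (simp add: arc_join)
    moreover have "path_image (g +++ h) = drawing (path_edges (x # y # zs))"
      using g h by (simp add: path_image_join drawing_def)
    ultimately show ?thesis
      using g h by (intro exI[of _ "g +++ h"]) simp
  qed
qed auto

lemma drawing_paths_Int:
  assumes "distinct (a # l @ [b])" "distinct (a # r @ [b])" "set l \<inter> set r = {}"
    and "l \<noteq> [] \<or> r \<noteq> []"
    and "path_edges (a # l @ [b]) \<subseteq> E" "path_edges (a # r @ [b]) \<subseteq> E"
  shows "drawing (path_edges (a # l @ [b])) \<inter> drawing (path_edges (a # r @ [b])) = {p a, p b}"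
proof
  have U: "\<Union>(path_edges (a # l @ [b])) = set (a # l @ [b])" "\<Union>(path_edges (a # r @ [b])) = set (a # r @ [b])"
    by (rule Union_path_edges; simp)+
  have "drawing (path_edges (a # l @ [b])) \<inter> drawing (path_edges (a # r @ [b])) \<subseteq>
      p ` (\<Union>(path_edges (a # l @ [b])) \<inter> \<Union>(path_edges (a # r @ [b])))"
    using assms by (intro drawing_Int path_edges_disjoint)
  also have "\<Union>(path_edges (a # l @ [b])) \<inter> \<Union>(path_edges (a # r @ [b])) = {a, b}"
    unfolding U using assms by auto
  finally show "drawing (path_edges (a # l @ [b])) \<inter> drawing (path_edges (a # r @ [b])) \<subseteq> {p a, p b}"
    by simp
  have ab: "a \<in> \<Union>E" "b \<in> \<Union>E"
    using U Union_mono[OF assms(5)] by auto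
  show "{p a, p b} \<subseteq> drawing (path_edges (a # l @ [b])) \<inter> drawing (path_edges (a # r @ [b]))"
    using assms ab U by (simp add: vertex_in_drawing_iff)
qed

text \<open>Cut at its closing edge, the cycle consists of two paths from \<open>a\<close> to
  \<open>b\<close>, one of them a single edge.\<close>

lemma cycle_Jordan:
  assumes "distinct xs" "3 \<le> length xs" "cycle_edges xs \<subseteq> E" "X = drawing (cycle_edges xs)"
  shows "inside X \<noteq> {}" "outside X \<noteq> {}" "frontier (inside X) = X" "frontier (outside X) = X"
proof -
  obtain a l b where xs: "xs = a # l @ [b]" "l \<noteq> []"
    using cycle_list_split[OF assms(2,1)] .
  have C: "cycle_edges xs = path_edges (a # l @ [b]) \<union> path_edges (a # [] @ [b])"
    using cycle_edges_split[of a l b "[]"] xs by simp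
  obtain c1 where c1: "arc c1" "path_image c1 = drawing (path_edges (a # l @ [b]))"
    "pathstart c1 = p a" "pathfinish c1 = p b"
    using path_arc[of "a # l @ [b]"] assms xs C by auto
  obtain c2 where c2: "arc c2" "path_image c2 = drawing (path_edges (a # [] @ [b]))"
    "pathstart c2 = p a" "pathfinish c2 = p b"
    using path_arc[of "a # [] @ [b]"] assms xs C by auto
  have Int: "path_image c1 \<inter> path_image c2 = {p a, p b}"
    unfolding c1(2) c2(2) using assms xs C by (intro drawing_paths_Int) auto
  have Un: "X = path_image c1 \<union> path_image c2"
    unfolding c1(2) c2(2) assms(4) C by (rule drawing_Un)
  show "inside X \<noteq> {}" "outside X \<noteq> {}" "frontier (inside X) = X" "frontier (outside X) = X"
    by (rule Jordan_two_arcs[OF c1(1,3,4) c2(1,3,4) Int Un])+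
qed

text \<open>
  A face records its region next to its boundary cycle because a plane cycle has two
  faces with the same boundary.
\<close>

definition face_system :: "'a set set \<Rightarrow> ('a list \<times> complex set) set \<Rightarrow> bool" where
  "face_system D F \<longleftrightarrow> finite F \<and> card F + card (\<Union>D) = card D + 2 \<and>
     (\<forall>xs R. (xs, R) \<in> F \<longrightarrow> distinct xs \<and> 3 \<le> length xs \<and> cycle_edges xs \<subseteq> D \<and> R \<inter> drawing D = {} \<and>
        R \<in> {inside (drawing (cycle_edges xs)), outside (drawing (cycle_edges xs))}) \<and>
     (\<forall>f \<in> F. \<forall>g \<in> F. f \<noteq> g \<longrightarrow> snd f \<inter> snd g = {}) \<and>
     - drawing D \<subseteq> \<Union>(snd ` F) \<and>
     (\<forall>e \<in> D. card {f \<in> F. e \<in> cycle_edges (fst f)} = 2)"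

lemma face_systemD:
  assumes "face_system D F"
  shows "finite F" "card F + card (\<Union>D) = card D + 2"
    and "\<And>xs R. (xs, R) \<in> F \<Longrightarrow> distinct xs \<and> 3 \<le> length xs \<and> cycle_edges xs \<subseteq> D \<and>
      R \<inter> drawing D = {} \<and> R \<in> {inside (drawing (cycle_edges xs)), outside (drawing (cycle_edges xs))}"
    and "\<And>f g. f \<in> F \<Longrightarrow> g \<in> F \<Longrightarrow> f \<noteq> g \<Longrightarrow> snd f \<inter> snd g = {}"
    and "- drawing D \<subseteq> \<Union>(snd ` F)"
    and "\<And>e. e \<in> D \<Longrightarrow> card {f \<in> F. e \<in> cycle_edges (fst f)} = 2"
  using assms unfolding face_system_def by simp_all

text \<open>The faces are the two sides of the Jordan curve, and Euler's equation holds because a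
  cycle has as many edges as vertices.\<close>

lemma face_system_cycle:
  assumes "distinct xs" "3 \<le> length xs" "cycle_edges xs \<subseteq> E"
  shows "\<exists>F. face_system (cycle_edges xs) F"
proof -
  let ?X = "drawing (cycle_edges xs)"
  let ?F = "{(xs, inside ?X), (xs, outside ?X)}"
  note J = cycle_Jordan[OF assms refl]
  have ne: "inside ?X \<noteq> outside ?X"
    using J(1) inside_Int_outside[of ?X] by blast
  have "{f \<in> ?F. e \<in> cycle_edges (fst f)} = ?F" if "e \<in> cycle_edges xs" for e
    using that by auto
  then have "\<forall>e \<in> cycle_edges xs. card {f \<in> ?F. e \<in> cycle_edges (fst f)} = 2"
    using ne by simp
  then have "face_system (cycle_edges xs) ?F"
    unfolding face_system_def
    using assms ne
    by (auto simp: card_cycle_edges Union_cycle_edges distinct_card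
        inside_no_overlap outside_no_overlap Int_commute[of "outside ?X" "inside ?X"])
  then show ?thesis by blast
qed

text \<open>The interior of the ear lies in one region \<open>R\<close>, whose boundary cycle passes
  through \<open>a\<close> and \<open>b\<close>, so \<open>theta_split\<close> divides
  \<open>R\<close>. This adds one face, \<open>length m\<close> vertices and
  \<open>length m + 1\<close> edges, which preserves Euler's equation.\<close>

lemma face_system_add_ear:
  assumes F: "face_system D F" and D: "D \<subseteq> E"
    and ab: "a \<in> \<Union>D" "b \<in> \<Union>D"
    and P: "distinct (a # m @ [b])" "set m \<inter> \<Union>D = {}" "path_edges (a # m @ [b]) \<subseteq> E - D"
  shows "\<exists>F'. face_system (D \<union> path_edges (a # m @ [b])) F'"
proof -
  define M where "M = path_edges (a # m @ [b])"
  have UM: "\<Union>M = insert a (insert b (set m))"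
    unfolding M_def using Union_path_edges[of "a # m @ [b]"] by auto
  have ME: "M \<subseteq> E" "M \<inter> D = {}" and finD: "finite D"
    using P(3) D finite_E finite_subset by (auto simp: M_def)
  have finUD: "finite (\<Union>D)"
  proof (rule finite_Union[OF finD])
    show "finite e" if "e \<in> D" for e
      using that D card_edge by (intro card_ge_0_finite) auto
  qed
  obtain c where c: "arc c" "path_image c = drawing M" "pathstart c = p a" "pathfinish c = p b"
    using path_arc[of "a # m @ [b]"] P ME by (auto simp: M_def)
  define I where "I = path_image c - {p a, p b}"
  have I: "I = c ` {0<..<1}"
    using simple_path_endless[OF arc_imp_simple_path[OF c(1)]] c by (simp add: I_def)
  have conI: "topological_space_class.connected I"
    using connected_simple_path_endless[OF arc_imp_simple_path[OF c(1)]] c by (simp add: I_def)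
  have "drawing M \<inter> drawing D \<subseteq> p ` (\<Union>M \<inter> \<Union>D)"
    using ME D by (intro drawing_Int)
  also have "\<dots> \<subseteq> {p a, p b}"
    unfolding UM using P by auto
  finally have ID: "I \<inter> drawing D = {}"
    using c by (auto simp: I_def)
  note fin = face_systemD(1)[OF F] and euler = face_systemD(2)[OF F]
    and faces = face_systemD(3)[OF F] and disj = face_systemD(4)[OF F]
    and cover = face_systemD(5)[OF F] and two = face_systemD(6)[OF F]
  \<comment> \<open>The midpoint of the ear serves to locate the face that is split.\<close>
  have "c (1/2) \<in> I"
    unfolding I by simp
  moreover from this have "c (1/2) \<in> \<Union>(snd ` F)"
    using ID cover by blast
  ultimately obtain xs R where f: "(xs, R) \<in> F" "I \<inter> R \<noteq> {}"
    by force
  define X where "X = drawing (cycle_edges xs)"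
  have xs: "distinct xs" "3 \<le> length xs" "cycle_edges xs \<subseteq> D" and RD: "R \<inter> drawing D = {}"
    and R: "R \<in> {inside X, outside X}"
    using faces[OF f(1)] by (auto simp: X_def)
  have XD: "X \<subseteq> drawing D"
    unfolding X_def using xs(3) by (rule drawing_mono)
  have J: "frontier (inside X) = X" "frontier (outside X) = X"
    using cycle_Jordan[OF xs(1,2) _ X_def] xs(3) D by auto
  have "I \<subseteq> inside X \<or> I \<subseteq> outside X"
    using ID XD conI J by (intro connected_inside_or_outside) auto
  then have IR: "I \<subseteq> R"
    using R f(2) inside_Int_outside[of X] by blast
  \<comment> \<open>The ends of the ear are limits of points of \<open>I\<close>, so they lie in the
    closure of \<open>R\<close>. Being vertices of \<open>D\<close>, they are not in
    \<open>R\<close>, hence on its frontier \<open>X\<close>.\<close>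
  have clR: "path_image c \<subseteq> closure R"
  proof -
    have "c ` closure {0<..<1} \<subseteq> closure R"
      using arc_imp_path[OF c(1)] IR closure_subset[of R] unfolding I
      by (intro image_closure_subset) (auto simp: path_def)
    then show ?thesis
      by (simp add: path_image_def)
  qed
  have on_X: "x \<in> set xs" if "x \<in> {a, b}" for x
  proof -
    have x: "x \<in> \<Union>D" "p x \<in> path_image c"
      using that ab c pathstart_in_path_image[of c] pathfinish_in_path_image[of c] by auto
    then have "p x \<in> R \<union> X"
      using clR R J unfolding closure_Un_frontier by auto
    moreover have "p x \<in> drawing D"
      using x D by (subst vertex_in_drawing_iff) auto
    ultimately have "p x \<in> X"
      using RD by blast
    then have "x \<in> \<Union>(cycle_edges xs)"
      unfolding X_def using x xs D by (subst (asm) vertex_in_drawing_iff) auto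
    then show ?thesis
      using Union_cycle_edges[of xs] xs(2) by simp
  qed
  obtain l r where lr: "cycle_edges (a # l @ b # r) = cycle_edges xs" "distinct (a # l @ b # r)"
    "set (a # l @ b # r) = set xs" "length (a # l @ b # r) = length xs"
  proof -
    obtain ys where ys: "cycle_edges (a # ys) = cycle_edges xs" "distinct (a # ys)"
      "set (a # ys) = set xs" "length (a # ys) = length xs"
      using cycle_list_from[of a xs] on_X xs by auto
    moreover have "b \<in> set ys"
      using ys(3) on_X[of b] P by auto
    then obtain l r where "ys = l @ b # r"
      by (meson split_list)
    ultimately show ?thesis
      using that by blast
  qed
  define Q1 where "Q1 = path_edges (a # l @ [b])"
  define Q2 where "Q2 = path_edges (a # rev r @ [b])"
  have Q: "cycle_edges xs = Q1 \<union> Q2"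
    using lr(1) cycle_edges_split[of a l b r] by (simp add: Q1_def Q2_def)
  have lr_ne: "l \<noteq> [] \<or> rev r \<noteq> []"
    using lr(4) xs(2) by auto
  have Q12: "Q1 \<inter> Q2 = {}"
    unfolding Q1_def Q2_def using lr(2) lr_ne by (intro path_edges_disjoint) auto
  have QD: "Q1 \<subseteq> D" "Q2 \<subseteq> D"
    using Q xs by auto
  have "set (l @ r) \<subseteq> \<Union>D"
    using lr(3) Union_cycle_edges[of xs] xs(2) Union_mono[OF xs(3)] by auto
  then have mdisj: "set l \<inter> set m = {}" "set (rev r) \<inter> set m = {}"
    using P by auto
  \<comment> \<open>Otherwise \<open>{a, b}\<close> would be an edge both of \<open>D\<close> and of
    the ear. Consequently the new cycles have at least three vertices.\<close>
  have m_ne: "l \<noteq> [] \<or> m \<noteq> []" "rev r \<noteq> [] \<or> m \<noteq> []"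
    using ME QD by (auto simp: Q1_def Q2_def M_def)
  obtain c1 where c1: "arc c1" "path_image c1 = drawing Q1" "pathstart c1 = p a" "pathfinish c1 = p b"
    using path_arc[of "a # l @ [b]"] lr(2) QD D by (auto simp: Q1_def)
  obtain c2 where c2: "arc c2" "path_image c2 = drawing Q2" "pathstart c2 = p a" "pathfinish c2 = p b"
    using path_arc[of "a # rev r @ [b]"] lr(2) QD D by (auto simp: Q2_def)
  have i12: "path_image c1 \<inter> path_image c2 = {p a, p b}"
    unfolding c1(2) c2(2) Q1_def Q2_def using lr(2) lr_ne QD D
    by (intro drawing_paths_Int) (auto simp: Q1_def Q2_def)
  have i1: "path_image c1 \<inter> path_image c = {p a, p b}"
    unfolding c1(2) c(2) Q1_def M_def using lr(2) m_ne mdisj QD D P ME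
    by (intro drawing_paths_Int) (auto simp: Q1_def M_def)
  have i2: "path_image c2 \<inter> path_image c = {p a, p b}"
    unfolding c2(2) c(2) Q2_def M_def using lr(2) m_ne mdisj QD D P ME
    by (intro drawing_paths_Int) (auto simp: Q2_def M_def)
  have "path_image c1 \<union> path_image c2 = X"
    unfolding c1(2) c2(2) X_def Q by (simp only: drawing_Un)
  then have R': "R \<in> {inside (path_image c1 \<union> path_image c2), outside (path_image c1 \<union> path_image c2)}"
    using R by simp
  obtain R1 R2 where
    R12: "R1 \<in> {inside (path_image c1 \<union> path_image c), outside (path_image c1 \<union> path_image c)}"
    "R2 \<in> {inside (path_image c2 \<union> path_image c), outside (path_image c2 \<union> path_image c)}"
    "R1 \<inter> R2 = {}" "R1 \<union> R2 \<union> I = R"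
    by (rule theta_split[OF c1(1,3,4) c2(1,3,4) c(1,3,4) i12 i1 i2 R' IR[unfolded I_def], folded I_def])
  define f1 where "f1 = (a # l @ b # rev m, R1)"
  define f2 where "f2 = (a # rev r @ b # rev m, R2)"
  have C1: "cycle_edges (fst f1) = Q1 \<union> M" and C2: "cycle_edges (fst f2) = Q2 \<union> M"
    using cycle_edges_split[of a l b "rev m"] cycle_edges_split[of a "rev r" b "rev m"]
    by (simp_all add: f1_def f2_def Q1_def Q2_def M_def)
  have R1: "R1 \<in> {inside (drawing (Q1 \<union> M)), outside (drawing (Q1 \<union> M))}"
    and R2: "R2 \<in> {inside (drawing (Q2 \<union> M)), outside (drawing (Q2 \<union> M))}"
    using R12 c1 c2 c by (simp_all add: drawing_Un)
  have avoid: "R1 \<inter> drawing (Q1 \<union> M) = {}" "R2 \<inter> drawing (Q2 \<union> M) = {}"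
    using R1 R2 inside_no_overlap outside_no_overlap by blast+
  let ?f = "(xs, R)"
  define F' where "F' = insert f1 (insert f2 (F - {?f}))"
  have ne: "M \<noteq> {}" "Q1 \<noteq> {}"
    using UM Union_path_edges[of "a # l @ [b]"] by (auto simp: Q1_def)
  have "g \<notin> F" if "M \<subseteq> cycle_edges (fst g)" for g
    using that ne(1) ME(2) faces[of "fst g" "snd g"] by fastforce
  then have new: "f1 \<notin> F" "f2 \<notin> F"
    using C1 C2 by auto
  have f12: "f1 \<noteq> f2"
  proof
    assume "f1 = f2"
    then have "Q1 \<union> M = Q2 \<union> M"
      using C1 C2 by simp
    then show False
      using Q12 ne(2) QD(1) ME(2) by blast
  qed
  have DM: "drawing (D \<union> M) = drawing D \<union> drawing M"
    by (rule drawing_Un)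
  have Msub: "drawing M \<subseteq> drawing D \<union> I"
    using c(2) vertex_in_drawing_iff[OF D, of a] vertex_in_drawing_iff[OF D, of b] ab D
    unfolding I_def by auto
  have other: "S \<inter> R = {}" if "(ys, S) \<in> F - {?f}" for ys S
    using disj[of "(ys, S)" ?f] that f(1) by auto
  have "face_system (D \<union> M) F'"
    unfolding face_system_def
  proof (intro conjI)
    show "finite F'"
      using fin by (simp add: F'_def)
    have "card F' = Suc (card F)"
      using new f12 f(1) fin card_Suc_Diff1[OF fin f(1)] by (simp add: F'_def)
    moreover have "card (D \<union> M) = card D + (length m + 1)"
      using finD ME card_path_edges[OF P(1)] by (subst card_Un_disjoint) (auto simp: M_def)
    moreover have "\<Union>(D \<union> M) = \<Union>D \<union> set m"
      using UM ab by auto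
    then have "card (\<Union>(D \<union> M)) = card (\<Union>D) + length m"
      using P finUD by (simp add: card_Un_disjoint Int_commute distinct_card)
    ultimately show "card F' + card (\<Union>(D \<union> M)) = card (D \<union> M) + 2"
      using euler by simp
    show "\<forall>xs R. (xs, R) \<in> F' \<longrightarrow> distinct xs \<and> 3 \<le> length xs \<and> cycle_edges xs \<subseteq> D \<union> M \<and>
        R \<inter> drawing (D \<union> M) = {} \<and> R \<in> {inside (drawing (cycle_edges xs)), outside (drawing (cycle_edges xs))}"
    proof (intro allI impI)
      fix ys S assume "(ys, S) \<in> F'"
      then consider "(ys, S) = f1" | "(ys, S) = f2" | "(ys, S) \<in> F - {?f}"
        by (auto simp: F'_def)
      then show "distinct ys \<and> 3 \<le> length ys \<and> cycle_edges ys \<subseteq> D \<union> M \<and>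
        S \<inter> drawing (D \<union> M) = {} \<and> S \<in> {inside (drawing (cycle_edges ys)), outside (drawing (cycle_edges ys))}"
      proof cases
        case 1
        have "distinct ys" "3 \<le> length ys"
          using 1 lr(2) P m_ne mdisj by (auto simp: f1_def Suc_le_eq)
        moreover have "cycle_edges ys = Q1 \<union> M" "S = R1"
          using C1 1 by (auto simp: f1_def)
        moreover have "R1 \<inter> drawing (D \<union> M) = {}"
          using avoid(1) R12(4) RD unfolding drawing_Un by blast
        ultimately show ?thesis
          using R1 QD by auto
      next
        case 2
        have "distinct ys" "3 \<le> length ys"
          using 2 lr(2) P m_ne mdisj by (auto simp: f2_def Suc_le_eq)
        moreover have "cycle_edges ys = Q2 \<union> M" "S = R2"
          using C2 2 by (auto simp: f2_def)
        moreover have "R2 \<inter> drawing (D \<union> M) = {}"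
          using avoid(2) R12(4) RD unfolding drawing_Un by blast
        ultimately show ?thesis
          using R2 QD by auto
      next
        case 3
        then have "(ys, S) \<in> F"
          by simp
        note ys = faces[OF this]
        have "S \<inter> drawing (D \<union> M) = {}"
          using other[OF 3] ys Msub IR unfolding DM by blast
        then show ?thesis
          using ys by blast
      qed
    qed
    have "S \<inter> R1 = {}" "S \<inter> R2 = {}" if "(ys, S) \<in> F - {?f}" for ys S
      using other[OF that] R12(4) by blast+
    then have "snd g \<inter> snd f1 = {}" "snd g \<inter> snd f2 = {}" if "g \<in> F - {?f}" for g
      using that by (cases g; simp add: f1_def f2_def)+
    then show "\<forall>f\<in>F'. \<forall>g\<in>F'. f \<noteq> g \<longrightarrow> snd f \<inter> snd g = {}"
      using disj R12(3) unfolding F'_def by (auto simp: f1_def f2_def Int_commute)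
    show "- drawing (D \<union> M) \<subseteq> \<Union>(snd ` F')"
    proof
      fix z assume z: "z \<in> - drawing (D \<union> M)"
      then obtain g where g: "g \<in> F" "z \<in> snd g"
        using cover by (auto simp: DM)
      show "z \<in> \<Union>(snd ` F')"
      proof (cases "g = ?f")
        case True
        then have "z \<in> R1 \<union> R2"
          using g R12(4) z c(2) by (auto simp: DM I_def)
        then show ?thesis
          by (auto simp: F'_def f1_def f2_def)
      qed (use g in \<open>auto simp: F'_def\<close>)
    qed
    show "\<forall>e\<in>D \<union> M. card {f \<in> F'. e \<in> cycle_edges (fst f)} = 2"
    proof
      fix e assume e: "e \<in> D \<union> M"
      let ?S = "{f \<in> F. e \<in> cycle_edges (fst f)}"
      show "card {f \<in> F'. e \<in> cycle_edges (fst f)} = 2"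
      proof (cases "e \<in> M")
        case True
        then have "?S = {}"
          using faces ME by fastforce
        then have "{f \<in> F'. e \<in> cycle_edges (fst f)} = {f1, f2}"
          using True C1 C2 by (auto simp: F'_def)
        then show ?thesis
          using f12 by simp
      next
        case False
        then have eD: "e \<in> D"
          using e by simp
        have S: "finite ?S" "card ?S = 2"
          using fin two[OF eD] by auto
        \<comment> \<open>An edge of \<open>Q1\<close> exchanges the face \<open>?f\<close> for
          \<open>f1\<close>, an edge of \<open>Q2\<close> exchanges it for \<open>f2\<close>, and
          the other edges of \<open>D\<close> keep their two faces.\<close>
        consider "e \<in> Q1" "e \<notin> Q2" | "e \<in> Q2" "e \<notin> Q1" | "e \<notin> Q1" "e \<notin> Q2"
          using Q12 by blast
        then show ?thesis
        proof cases
          case 1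
          then have "{f \<in> F'. e \<in> cycle_edges (fst f)} = insert f1 (?S - {?f})"
            using False C1 C2 by (auto simp: F'_def)
          moreover have "?f \<in> ?S"
            using 1 Q f(1) by simp
          ultimately show ?thesis
            using S new by (simp add: card_Suc_Diff1)
        next
          case 2
          then have "{f \<in> F'. e \<in> cycle_edges (fst f)} = insert f2 (?S - {?f})"
            using False C1 C2 by (auto simp: F'_def)
          moreover have "?f \<in> ?S"
            using 2 Q f(1) by simp
          ultimately show ?thesis
            using S new by (simp add: card_Suc_Diff1)
        next
          case 3
          then have "{f \<in> F'. e \<in> cycle_edges (fst f)} = ?S"
            using False C1 C2 Q by (auto simp: F'_def)
          then show ?thesis
            using S by simp
        qed
      qed
    qed
  qed
  then show ?thesis
    unfolding M_def by blast
qed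

text \<open>Two disjoint regions with the same boundary curve are its inside and its outside. They
  cover everything off the curve, so nothing of \<open>D\<close> is drawn off it, whereas a further
  edge would have inner points there.\<close>

lemma face_system_inj:
  assumes F: "face_system D F" and D: "D \<subseteq> E"
    and fg: "f \<in> F" "g \<in> F" "cycle_edges (fst f) = cycle_edges (fst g)" "f \<noteq> g"
  shows "D = cycle_edges (fst f)"
proof (rule ccontr)
  assume neq: "D \<noteq> cycle_edges (fst f)"
  define X where "X = drawing (cycle_edges (fst f))"
  have f: "distinct (fst f)" "3 \<le> length (fst f)" "cycle_edges (fst f) \<subseteq> D" "snd f \<in> {inside X, outside X}"
    "snd f \<inter> drawing D = {}"
   and g: "snd g \<in> {inside X, outside X}" "snd g \<inter> drawing D = {}"
   and disj: "snd f \<inter> snd g = {}"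
    using face_systemD(3)[OF F, of "fst f" "snd f"] face_systemD(3)[OF F, of "fst g" "snd g"]
      face_systemD(4)[OF F] fg by (simp_all add: X_def)
  have "inside X \<noteq> {}" "outside X \<noteq> {}"
    using cycle_Jordan[OF f(1,2) _ X_def] f D by auto
  then have "inside X \<union> outside X = snd f \<union> snd g"
    using f(4) g(1) disj by blast
  then have *: "drawing D \<subseteq> X"
    using f(5) g(2) inside_Un_outside[of X] by blast
  obtain e where e: "e \<in> D" "e \<notin> cycle_edges (fst f)"
    using neq f by auto
  have sp: "simple_path (\<gamma> e)"
    using arc_edge e D by (blast intro: arc_imp_simple_path)
  obtain z where z: "z \<in> path_image (\<gamma> e)" "z \<notin> p ` e"
    using nonempty_simple_path_endless[OF sp] ends_edge[of e] e D by blast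
  then have "z \<in> drawing {e} \<inter> drawing (cycle_edges (fst f))"
    using * e by (auto simp: drawing_def X_def)
  moreover have "drawing {e} \<inter> drawing (cycle_edges (fst f)) \<subseteq> p ` (\<Union>{e} \<inter> \<Union>(cycle_edges (fst f)))"
    using e f(3) D by (intro drawing_Int) auto
  ultimately have "z \<in> p ` (\<Union>{e} \<inter> \<Union>(cycle_edges (fst f)))"
    by (rule subsetD[rotated])
  then show False
    using z(2) by auto
qed

end

subsection \<open>Ear decompositions\<close>

lemma rtrancl_crossing_step:
  assumes "(s, t) \<in> r\<^sup>*" "s \<in> W" "t \<notin> W"
  obtains x y where "(x, y) \<in> r" "x \<in> W" "y \<notin> W"
proof -
  have "\<exists>x y. (x, y) \<in> r \<and> x \<in> W \<and> y \<notin> W"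
    using assms by (induction rule: rtrancl_induct) auto
  then show ?thesis
    using that by blast
qed

text \<open>A walk is turned into a path from its far end: if \<open>y\<close> already occurs on the
  path from \<open>z\<close>, only the part from that occurrence on is kept; if \<open>z\<close> is
  in \<open>W\<close>, the path stops there. As the relation avoids \<open>x\<close>, so does the
  end \<open>b\<close>.\<close>

lemma path_to_set:
  assumes "(y, w) \<in> {(s, t). {s, t} \<in> E \<and> s \<noteq> x \<and> t \<noteq> x}\<^sup>*" "w \<in> W" "y \<notin> W"
  shows "\<exists>m b. b \<in> W \<and> b \<noteq> x \<and> distinct (y # m @ [b]) \<and> set (y # m) \<inter> W = {} \<and>
           path_edges (y # m @ [b]) \<subseteq> E"
  using assms
proof (induction rule: converse_rtrancl_induct)
  case (step y z)
  show ?case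
  proof (cases "z \<in> W")
    case True
    then show ?thesis
      using step by (intro exI[of _ "[]"] exI[of _ z]) auto
  next
    case False
    then obtain m b where m: "b \<in> W" "b \<noteq> x" "distinct (z # m @ [b])" "set (z # m) \<inter> W = {}"
      "path_edges (z # m @ [b]) \<subseteq> E"
      using step by blast
    show ?thesis
    proof (cases "y \<in> set (z # m)")
      case True
      then obtain l r where lr: "z # m = l @ y # r"
        by (meson split_list)
      then have eq: "z # m @ [b] = l @ y # r @ [b]"
        by simp
      have "path_edges (y # r @ [b]) \<subseteq> E"
        using m(5) path_edges_append[of l y "r @ [b]"] unfolding eq by blast
      moreover have "distinct (y # r @ [b])"
        using m(3) unfolding eq by auto
      moreover have "set (y # r) \<inter> W = {}"
        using m(4) unfolding lr by auto
      ultimately show ?thesis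
        using m(1,2) by blast
    next
      case False
      then show ?thesis
        using m step by (intro exI[of _ "z # m"] exI[of _ b]) auto
    qed
  qed
qed simp

locale two_connected_plane_graph = plane_graph +
  assumes two_connected: "u \<in> \<Union>E \<Longrightarrow> w \<in> \<Union>E \<Longrightarrow> u \<noteq> x \<Longrightarrow> w \<noteq> x \<Longrightarrow>
    (u, w) \<in> {(s, t). {s, t} \<in> E \<and> s \<noteq> x \<and> t \<noteq> x}\<^sup>*"
begin

text \<open>If no missing edge joins two vertices of \<open>W\<close>, some edge leaves
  \<open>W\<close> at a vertex \<open>x\<close>. Two-connectedness brings its outer end back to
  \<open>W\<close> without using \<open>x\<close>, so the ear has two different ends.\<close>

lemma exists_ear:
  assumes W: "u \<in> W" "w \<in> W" "u \<noteq> w" "W \<subseteq> \<Union>E"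
    and D: "D \<subseteq> E" "D \<noteq> E" "\<Union>D \<subseteq> W"
  obtains a m b where "a \<in> W" "b \<in> W" "distinct (a # m @ [b])" "set m \<inter> W = {}"
    "path_edges (a # m @ [b]) \<subseteq> E - D"
proof (cases "\<exists>e \<in> E - D. e \<subseteq> W")
  case True
  then obtain e where e: "e \<in> E - D" "e \<subseteq> W"
    by blast
  then obtain a b where "e = {a, b}" "a \<noteq> b"
    using card_edge[of e] by (auto simp: card_2_iff)
  then show ?thesis
    using that[of a b "[]"] e by auto
next
  case False
  obtain e where e: "e \<in> E - D"
    using D by blast
  then obtain v where v: "v \<in> \<Union>E" "v \<notin> W"
    using False by blast
  have "(w, v) \<in> {(s, t). {s, t} \<in> E \<and> s \<noteq> u \<and> t \<noteq> u}\<^sup>*"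
    using W v by (intro two_connected) auto
  then obtain x y where xy: "{x, y} \<in> E" "x \<in> W" "y \<notin> W"
    using rtrancl_crossing_step[OF _ W(2) v(2)] by blast
  obtain z where z: "z \<in> W" "z \<noteq> x"
    using W by metis
  have "(y, z) \<in> {(s, t). {s, t} \<in> E \<and> s \<noteq> x \<and> t \<noteq> x}\<^sup>*"
    using z xy W by (intro two_connected) auto
  from path_to_set[OF this z(1) xy(3)] obtain m b where m: "b \<in> W" "b \<noteq> x" "distinct (y # m @ [b])"
    "set (y # m) \<inter> W = {}" "path_edges (y # m @ [b]) \<subseteq> E"
    by blast
  let ?P = "x # (y # m) @ [b]"
  have dist: "distinct ?P"
    using m xy by auto
  \<comment> \<open>An edge of \<open>D\<close> on the ear would have both ends in \<open>W\<close>,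
    hence join \<open>x\<close> and \<open>b\<close>, but the ear has the inner vertex
    \<open>y\<close>.\<close>
  have "e \<notin> D" if e: "e \<in> path_edges ?P" for e
  proof
    assume "e \<in> D"
    then have "e \<subseteq> {x, b}"
      using D(3) path_edges_subset[OF e] m(4) by auto
    moreover have "card e = 2"
      using card_path_edge[OF dist e] .
    ultimately have "e = {x, b}"
      using m(2) by (intro card_subset_eq) auto
    then show False
      using end_edge_of_path[OF dist] e by simp
  qed
  moreover have "path_edges ?P \<subseteq> E"
    using m xy by simp
  ultimately show ?thesis
    using that[of x b "y # m"] dist m xy by blast
qed

lemma face_system_extend:
  assumes "face_system D F" "D \<subseteq> E" "D \<noteq> {}"
  shows "\<exists>F. face_system E F"
  using assms
proof (induction "card (E - D)" arbitrary: D F rule: less_induct)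
  case less
  show ?case
  proof (cases "D = E")
    case True
    then show ?thesis
      using less by blast
  next
    case False
    obtain e where e: "e \<in> D"
      using less(4) by blast
    then have "card e = 2"
      using card_edge less(3) by blast
    then obtain u w where uw: "{u, w} \<in> D" "u \<noteq> w"
      using e by (auto simp: card_2_iff)
    then have "u \<in> \<Union>D" "w \<in> \<Union>D"
      using uw by auto
    from exists_ear[OF this uw(2) Union_mono[OF less(3)] less(3) False subset_refl]
    obtain a m b where P: "a \<in> \<Union>D" "b \<in> \<Union>D" "distinct (a # m @ [b])" "set m \<inter> \<Union>D = {}"
      "path_edges (a # m @ [b]) \<subseteq> E - D" .
    obtain F' where F': "face_system (D \<union> path_edges (a # m @ [b])) F'"
      using face_system_add_ear[OF less(2,3) P] by blast
    have "path_edges (a # m @ [b]) \<noteq> {}"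
      using Union_path_edges[of "a # m @ [b]"] by auto
    then have "E - (D \<union> path_edges (a # m @ [b])) \<subset> E - D"
      using P(5) by blast
    then have "card (E - (D \<union> path_edges (a # m @ [b]))) < card (E - D)"
      using finite_E by (intro psubset_card_mono) auto
    moreover have "D \<union> path_edges (a # m @ [b]) \<subseteq> E" "D \<union> path_edges (a # m @ [b]) \<noteq> {}"
      using less(3,4) P(5) by auto
    ultimately show ?thesis
      by (rule less(1)[OF _ F'])
  qed
qed

text \<open>The initial cycle comes from the ear lemma too: an ear attached to a single edge
  \<open>{u, w}\<close> avoids that edge and closes a cycle with it. A third vertex guarantees that
  this edge is not all of \<open>E\<close>.\<close>

lemma exists_face_system:
  assumes "2 < card (\<Union>E)"
  shows "\<exists>F. face_system E F"
proof -
  have "E \<noteq> {}"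
    using assms by auto
  then obtain e where "e \<in> E"
    by blast
  then obtain u w where uw: "{u, w} \<in> E" "u \<noteq> w"
    using card_edge[of e] by (auto simp: card_2_iff)
  have "{{u, w}} \<noteq> E"
    using assms uw by auto
  then obtain a m b where P: "a \<in> {u, w}" "b \<in> {u, w}" "distinct (a # m @ [b])"
    "path_edges (a # m @ [b]) \<subseteq> E - {{u, w}}"
    by (rule exists_ear[of u "{u, w}" w "{{u, w}}", rotated 5]) (use uw in auto)
  have ab: "{a, b} = {u, w}"
    using P by auto
  then have "m \<noteq> []"
    using P(4) by auto
  then have len: "3 \<le> length (a # m @ [b])"
    by (cases m) auto
  have C: "cycle_edges (a # m @ [b]) = path_edges (a # m @ [b]) \<union> {{a, b}}"
    using cycle_edges_split[of a m b "[]"] by simp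
  then have sub: "cycle_edges (a # m @ [b]) \<subseteq> E"
    using P(4) ab uw by auto
  obtain F where "face_system (cycle_edges (a # m @ [b])) F"
    using face_system_cycle[OF P(3) len sub] by blast
  then show ?thesis
    using face_system_extend sub C by blast
qed

end

subsection \<open>Discharging\<close>

context plane_graph
begin

lemma finite_Union_E: "finite (\<Union>E)"
proof (rule finite_Union[OF finite_E])
  show "finite e" if "e \<in> E" for e
    using that card_edge by (intro card_ge_0_finite) auto
qed

lemma edges_of_face_at:
  assumes F: "face_system E F" and f: "f \<in> F" "v \<in> set (fst f)"
  obtains ys where "cycle_edges (v # ys) = cycle_edges (fst f)" "distinct (v # ys)"
    "length (v # ys) = length (fst f)" "2 \<le> length ys"
    "{e \<in> cycle_edges (fst f). v \<in> e} = {{v, hd ys}, {v, last ys}}" "hd ys \<noteq> last ys"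
proof -
  have f3: "distinct (fst f)" "3 \<le> length (fst f)"
    using face_systemD(3)[OF F, of "fst f" "snd f"] f by auto
  obtain ys where ys: "cycle_edges (v # ys) = cycle_edges (fst f)" "distinct (v # ys)"
    "length (v # ys) = length (fst f)"
    using cycle_list_from[OF f(2) f3(1)] by metis
  moreover have len: "2 \<le> length ys"
    using ys(3) f3(2) by simp
  moreover have "{e \<in> cycle_edges (fst f). v \<in> e} = {{v, hd ys}, {v, last ys}}"
    using cycle_edges_at[OF ys(2) len] ys(1) by simp
  moreover have "hd ys \<noteq> last ys"
    using len ys(2) by (cases ys) (auto simp: Suc_le_eq)
  ultimately show ?thesis
    using that by blast
qed

lemma card_edges_of_face_at:
  assumes F: "face_system E F" and f: "f \<in> F" "v \<in> set (fst f)"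
  shows "card {e \<in> cycle_edges (fst f). v \<in> e} = 2"
proof -
  obtain ys where "distinct (v # ys)" "{e \<in> cycle_edges (fst f). v \<in> e} = {{v, hd ys}, {v, last ys}}"
    "hd ys \<noteq> last ys"
    using edges_of_face_at[OF assms] by metis
  then show ?thesis
    by (simp add: doubleton_eq_iff)
qed

lemma vertex_of_face_edge:
  assumes F: "face_system E F" and f: "f \<in> F" "e \<in> cycle_edges (fst f)" "v \<in> e"
  shows "v \<in> set (fst f)"
proof -
  have "3 \<le> length (fst f)"
    using face_systemD(3)[OF F, of "fst f" "snd f"] f by auto
  then have "\<Union>(cycle_edges (fst f)) = set (fst f)"
    by (intro Union_cycle_edges) simp
  then show ?thesis
    using f by blast
qed

text \<open>Double counting of the incidences at \<open>v\<close>: an edge lies on two faces, and a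
  face through \<open>v\<close> has two edges at \<open>v\<close>.\<close>

lemma card_faces_at:
  assumes F: "face_system E F"
  shows "card {f \<in> F. v \<in> set (fst f)} = card {e \<in> E. v \<in> e}"
proof -
  let ?S = "{f \<in> F. v \<in> set (fst f)}" and ?T = "{e \<in> E. v \<in> e}"
  have "card {f \<in> ?S. e \<in> cycle_edges (fst f)} = 2" if "e \<in> ?T" for e
  proof -
    have "{f \<in> ?S. e \<in> cycle_edges (fst f)} = {f \<in> F. e \<in> cycle_edges (fst f)}"
      using vertex_of_face_edge[OF F] that by blast
    then show ?thesis
      using face_systemD(6)[OF F, of e] that by simp
  qed
  then have "(\<Sum>f\<in>?S. card {e \<in> ?T. e \<in> cycle_edges (fst f)}) = 2 * card ?T"
    using finite_E face_systemD(1)[OF F] by (intro sum_multicount) auto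
  moreover have "card {e \<in> ?T. e \<in> cycle_edges (fst f)} = 2" if "f \<in> ?S" for f
  proof -
    have "{e \<in> ?T. e \<in> cycle_edges (fst f)} = {e \<in> cycle_edges (fst f). v \<in> e}"
      using face_systemD(3)[OF F, of "fst f" "snd f"] that by auto
    then show ?thesis
      using card_edges_of_face_at[OF F, of f v] that by simp
  qed
  ultimately show ?thesis
    by simp
qed

text \<open>The degrees sum to twice the number of edges, and every face hands out 1 in equal parts
  to its vertices, so the total is V - E + F, which Euler's equation evaluates.\<close>

lemma sum_face_charges:
  assumes F: "face_system E F"
  shows "(\<Sum>v\<in>\<Union>E. 1 - card {e \<in> E. v \<in> e} / 2 + (\<Sum>f | f \<in> F \<and> v \<in> set (fst f). 1 / length (fst f))) = (2::real)"
proof -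
  have "(\<Sum>v\<in>\<Union>E. card {e \<in> E. v \<in> e}) = 2 * card E"
  proof (rule sum_multicount[OF finite_Union_E finite_E], rule ballI)
    fix e assume e: "e \<in> E"
    then have "{v \<in> \<Union>E. v \<in> e} = e"
      by blast
    then show "card {v \<in> \<Union>E. v \<in> e} = 2"
      using card_edge[OF e] by simp
  qed
  then have deg: "(\<Sum>v\<in>\<Union>E. real (card {e \<in> E. v \<in> e})) = 2 * card E"
    by (metis of_nat_sum of_nat_mult of_nat_numeral)
  have "(\<Sum>v\<in>\<Union>E. \<Sum>f | f \<in> F \<and> v \<in> set (fst f). 1 / real (length (fst f)))
      = (\<Sum>f\<in>F. \<Sum>v | v \<in> \<Union>E \<and> v \<in> set (fst f). 1 / real (length (fst f)))"
    using finite_Union_E face_systemD(1)[OF F] by (rule sum.swap_restrict)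
  also have "\<dots> = (\<Sum>f\<in>F. 1)"
  proof (rule sum.cong[OF refl])
    fix f assume f: "f \<in> F"
    then have *: "distinct (fst f)" "3 \<le> length (fst f)" "cycle_edges (fst f) \<subseteq> E"
      using face_systemD(3)[OF F, of "fst f" "snd f"] by auto
    have "set (fst f) = \<Union>(cycle_edges (fst f))"
      using *(2) by (intro Union_cycle_edges[symmetric]) simp
    then have "{v. v \<in> \<Union>E \<and> v \<in> set (fst f)} = set (fst f)"
      using Union_mono[OF *(3)] by auto
    then show "(\<Sum>v | v \<in> \<Union>E \<and> v \<in> set (fst f). 1 / real (length (fst f))) = 1"
      using distinct_card[OF *(1)] *(2) by auto
  qed
  finally have "(\<Sum>v\<in>\<Union>E. \<Sum>f | f \<in> F \<and> v \<in> set (fst f). 1 / real (length (fst f))) = card F"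
    by simp
  moreover have "real (card F) + card (\<Union>E) = card E + 2"
    using face_systemD(2)[OF F] by linarith
  ultimately show ?thesis
    using deg by (simp add: sum.distrib sum_subtractf flip: sum_divide_distrib)
qed

lemma exists_light_vertex:
  assumes F: "face_system E F" and deg: "\<And>v. v \<in> \<Union>E \<Longrightarrow> 5 \<le> card {e \<in> E. v \<in> e}"
  obtains v f where "card {e \<in> E. v \<in> e} = 5" "f \<in> F" "v \<in> set (fst f)" "length (fst f) \<le> 5"
    "\<And>g. g \<in> F \<Longrightarrow> v \<in> set (fst g) \<Longrightarrow> g \<noteq> f \<Longrightarrow> length (fst g) = 3"
proof -
  let ?c = "\<lambda>v. 1 - card {e \<in> E. v \<in> e} / 2 + (\<Sum>f | f \<in> F \<and> v \<in> set (fst f). 1 / real (length (fst f)))"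
  have "\<not> (\<forall>v\<in>\<Union>E. ?c v \<le> 0)"
    using sum_face_charges[OF F] sum_nonpos[of "\<Union>E" ?c] by auto
  then obtain v where v: "v \<in> \<Union>E" "?c v > 0"
    by force
  let ?S = "{f \<in> F. v \<in> set (fst f)}"
  have S: "finite ?S" "card ?S = card {e \<in> E. v \<in> e}"
    using face_systemD(1)[OF F] card_faces_at[OF F] by auto
  have len: "3 \<le> length (fst f)" if "f \<in> F" for f
    using face_systemD(3)[OF F, of "fst f" "snd f"] that by simp
  have third: "1 / real (length (fst f)) \<le> 1/3" if "f \<in> F" for f
    using len[OF that] by (intro frac_le) auto
  \<comment> \<open>Faces have length at least 3, so a vertex of degree d has charge at most 1 - d/2
    + d/3 = 1 - d/6.\<close>
  have "(\<Sum>f\<in>?S. 1 / real (length (fst f))) \<le> card ?S * (1/3)"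
    using third by (intro sum_bounded_above) auto
  then have "real (card {e \<in> E. v \<in> e}) < 6"
    using v(2) S by simp
  then have five: "card {e \<in> E. v \<in> e} = 5"
    using deg[OF v(1)] by linarith
  then have big: "(\<Sum>f\<in>?S. 1 / real (length (fst f))) > 3/2"
    using v(2) by simp
  have "?S \<noteq> {}"
    using S(2) five by (metis card.empty zero_neq_numeral)
  then have "Max ((\<lambda>f. length (fst f)) ` ?S) \<in> (\<lambda>f. length (fst f)) ` ?S"
    using S(1) by (intro Max_in) blast+
  then obtain f where fS: "Max ((\<lambda>f. length (fst f)) ` ?S) = length (fst f)" and f: "f \<in> ?S"
    by (rule imageE)
  have longest: "length (fst g) \<le> length (fst f)" if "g \<in> ?S" for g
    unfolding fS[symmetric] using S(1) that by (intro Max_ge finite_imageI imageI)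
  \<comment> \<open>As \<open>f\<close> is a longest face at \<open>v\<close>, a second face that is
    not a triangle would make \<open>f\<close> have length at least 4 as well, and the sum would be
    at most 2/4 + 3/3 = 3/2.\<close>
  have tri: "length (fst g) = 3" if g: "g \<in> F" "v \<in> set (fst g)" "g \<noteq> f" for g
  proof (rule ccontr)
    assume "length (fst g) \<noteq> 3"
    then have "4 \<le> length (fst g)" "4 \<le> length (fst f)"
      using len[OF g(1)] longest[of g] g by auto
    moreover have "1 / real n \<le> 1/4" if "4 \<le> n" for n
      using that by (intro frac_le) auto
    ultimately have "1 / real (length (fst g)) \<le> 1/4" "1 / real (length (fst f)) \<le> 1/4"
      by blast+
    moreover have "(\<Sum>h\<in>?S - {f} - {g}. 1 / real (length (fst h))) \<le> card (?S - {f} - {g}) * (1/3)"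
      using third by (intro sum_bounded_above) auto
    moreover have "card (?S - {f} - {g}) = 3"
      using S f g five by simp
    moreover have "(\<Sum>h\<in>?S. 1 / real (length (fst h))) = 1 / real (length (fst f)) + 1 / real (length (fst g))
        + (\<Sum>h\<in>?S - {f} - {g}. 1 / real (length (fst h)))"
      using S f g by (simp add: sum.remove[of ?S f] sum.remove[of "?S - {f}" g])
    ultimately show False
      using big by simp
  qed
  have "(\<Sum>h\<in>?S. 1 / real (length (fst h))) = 1 / real (length (fst f)) + (\<Sum>h\<in>?S - {f}. 1 / real (length (fst h)))"
    using S f by (simp add: sum.remove[of ?S f])
  also have "(\<Sum>h\<in>?S - {f}. 1 / real (length (fst h))) = (\<Sum>h\<in>?S - {f}. 1/3)"
    using tri by (intro sum.cong) auto
  also have "\<dots> = 4/3"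
    using S f five by simp
  \<comment> \<open>The four triangles account for 4/3, so more than 3/2 - 4/3 is left for
    \<open>f\<close>.\<close>
  finally have "1 / real (length (fst f)) > 1/6"
    using big by simp
  moreover have "1 / real (length (fst f)) \<le> 1/6" if "6 \<le> length (fst f)"
    using that by (intro frac_le) auto
  ultimately have "length (fst f) < 6"
    by (meson not_less)
  then show ?thesis
    using that[of v f] five f tri by auto
qed

end

subsection \<open>The faces around a vertex of degree five\<close>

lemma five_elements:
  assumes "card N = 5" "{a, b, c, d, e} \<subseteq> N" "distinct [a, b, c, d, e]" "x \<in> N"
  shows "x \<in> {a, b, c, d, e}"
proof -
  have "finite N"
    using assms(1) by (intro card_ge_0_finite) simp
  moreover have "card {a, b, c, d, e} = 5"
    using assms(3) by simp
  ultimately have "{a, b, c, d, e} = N"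
    using assms(1,2) by (intro card_subset_eq) auto
  then show ?thesis
    using assms(4) by blast
qed

text \<open>
  A 2-regular multigraph on five vertices is a pentagon, or a triangle together with a
  digon, and injectivity forces \<open>f0\<close> to be one of the edges of the digon.
\<close>

lemma two_regular_on_five:
  fixes nb :: "'f \<Rightarrow> 'b set"
  assumes N: "card N = 5"
    and nb: "\<And>f. f \<in> F \<Longrightarrow> card (nb f) = 2 \<and> nb f \<subseteq> N"
    and two: "\<And>x. x \<in> N \<Longrightarrow> card {f \<in> F. x \<in> nb f} = 2"
    and f0: "f0 \<in> F" and inj: "inj_on nb (F - {f0})"
  shows "(\<exists>x y z. distinct [x, y, z] \<and> {{x, y}, {y, z}, {x, z}} \<subseteq> nb ` (F - {f0})) \<or>
    (\<exists>a b c d e. distinct [a, b, c, d, e] \<and> nb f0 = {a, e} \<and>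
       {{a, b}, {b, c}, {c, d}, {d, e}} \<subseteq> nb ` (F - {f0}))"
proof -
  \<comment> \<open>Each \<open>f\<close> is read as an edge with ends \<open>nb f\<close>. A vertex
    with two known edges has no third.\<close>
  have used: "h = f \<or> h = g" if "f \<in> F" "g \<in> F" "h \<in> F" "x \<in> nb f" "x \<in> nb g" "x \<in> nb h" "f \<noteq> g" for f g h x
  proof (rule ccontr)
    assume "\<not> ?thesis"
    then have "card {f, g, h} = 3"
      using that(7) by auto
    moreover have "x \<in> N"
      using that nb by blast
    then have "card {f \<in> F. x \<in> nb f} = 2"
      by (rule two)
    moreover from this have "card {f, g, h} \<le> card {f \<in> F. x \<in> nb f}"
      using that by (intro card_mono card_ge_0_finite) auto
    ultimately show False
      by simp
  qed
  \<comment> \<open>Every vertex can be left by an edge other than \<open>f\<close>. Starting at the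
    end \<open>a\<close> of \<open>f0\<close>, this walks along the component of
    \<open>f0\<close>.\<close>
  have other: "\<exists>g y. g \<in> F \<and> g \<noteq> f \<and> y \<in> N \<and> y \<noteq> x \<and> nb g = {x, y}" if "x \<in> N" for f x
  proof -
    obtain g h where gh: "{f \<in> F. x \<in> nb f} = {g, h}" "g \<noteq> h"
      using two[OF \<open>x \<in> N\<close>] by (auto simp: card_2_iff)
    then obtain k where k: "k \<in> F" "x \<in> nb k" "k \<noteq> f"
      by (cases "g = f") auto
    then obtain y where "nb k = {x, y}" "y \<noteq> x"
      using nb[OF k(1)] k(2) by (auto simp: card_2_iff doubleton_eq_iff)
    then show ?thesis
      using k nb[OF k(1)] by blast
  qed
  obtain a e where ae: "nb f0 = {a, e}" "a \<noteq> e" "a \<in> N" "e \<in> N"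
    using nb[OF f0] by (auto simp: card_2_iff)
  obtain f1 b where f1: "f1 \<in> F" "f1 \<noteq> f0" "b \<in> N" "b \<noteq> a" "nb f1 = {a, b}"
    using other[OF ae(3), of f0] by blast
  show ?thesis
  proof (cases "b = e")
    case True
    \<comment> \<open>Here \<open>f0\<close> and \<open>f1\<close> form a digon, and the three
      remaining vertices carry the triangle.\<close>
    have free: "{x, y} \<inter> {a, e} = {}" if "g \<in> F" "nb g = {x, y}" "g \<noteq> f0" "g \<noteq> f1" for g x y
      using used[OF f0 f1(1) that(1), of a] used[OF f0 f1(1) that(1), of e] ae f1 True that by auto
    have "\<not> N \<subseteq> {a, e}"
      using N card_mono[of "{a, e}" N] ae(2) by auto
    then obtain x where x: "x \<in> N" "x \<noteq> a" "x \<noteq> e"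
      by blast
    obtain g y where g: "g \<in> F" "g \<noteq> f0" "y \<in> N" "y \<noteq> x" "nb g = {x, y}"
      using other[OF x(1), of f0] by blast
    obtain h z where h: "h \<in> F" "h \<noteq> g" "z \<in> N" "z \<noteq> x" "nb h = {x, z}"
      using other[OF x(1), of g] by blast
    have gh: "g \<noteq> f1" "h \<noteq> f0" "h \<noteq> f1"
      using x g h ae f1 True by auto
    have yz: "y \<noteq> z"
      using inj_onD[OF inj, of g h] g h gh by auto
    have y: "y \<noteq> a" "y \<noteq> e" and z: "z \<noteq> a" "z \<noteq> e"
      using free[OF g(1,5,2) gh(1)] free[OF h(1,5) gh(2,3)] by auto
    obtain k w where k: "k \<in> F" "k \<noteq> g" "w \<in> N" "w \<noteq> y" "nb k = {y, w}"
      using other[OF g(3), of g] by blast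
    have kf: "k \<noteq> f0" "k \<noteq> f1" "k \<noteq> h"
      using k ae f1 h y yz g True by auto
    have w: "w \<noteq> a" "w \<noteq> e"
      using free[OF k(1,5) kf(1,2)] by auto
    have "w \<noteq> x"
      using used[OF g(1) h(1) k(1), of x] g(5) h(2,5) k(2,5) kf by auto
    moreover have "w \<in> {a, e, x, y, z}"
      using five_elements[OF N, of a e x y z w] ae x g h k y z yz by auto
    ultimately have "w = z"
      using w k(4) by auto
    then have "distinct [x, y, z]" "{{x, y}, {y, z}, {x, z}} \<subseteq> nb ` (F - {f0})"
      using g h k kf gh yz by (auto intro: rev_image_eqI)
    then show ?thesis
      by blast
  next
    case be: False
    obtain f2 c where f2: "f2 \<in> F" "f2 \<noteq> f1" "c \<in> N" "c \<noteq> b" "nb f2 = {b, c}"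
      using other[OF f1(3), of f1] by blast
    have f20: "f2 \<noteq> f0"
      using f2 ae f1 be by auto
    have ca: "c \<noteq> a"
      using used[OF f0 f1(1) f2(1), of a] ae f1 f2 f20 by auto
    show ?thesis
    proof (cases "c = e")
      case True
      \<comment> \<open>Here \<open>f0\<close>, \<open>f1\<close> and \<open>f2\<close> close a
        triangle. The two remaining vertices would carry a digon of \<open>g\<close> and
        \<open>h\<close>, which injectivity forbids since neither is \<open>f0\<close>.\<close>
      have free: "x \<notin> {a, b, e}" if "g \<in> F" "x \<in> nb g" "g \<notin> {f0, f1, f2}" for g x
        using used[OF f0 f1(1) that(1), of a] used[OF f1(1) f2(1) that(1), of b]
          used[OF f0 f2(1) that(1), of e] ae f1 f2 f20 True that by auto
      have "\<not> N \<subseteq> {a, b, e}"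
        using N card_mono[of "{a, b, e}" N] ae f1 be by auto
      then obtain x where x: "x \<in> N" "x \<notin> {a, b, e}"
        by blast
      obtain g y where g: "g \<in> F" "g \<noteq> f0" "y \<in> N" "y \<noteq> x" "nb g = {x, y}"
        using other[OF x(1), of f0] by blast
      obtain h z where h: "h \<in> F" "h \<noteq> g" "z \<in> N" "z \<noteq> x" "nb h = {x, z}"
        using other[OF x(1), of g] by blast
      have gh: "g \<notin> {f0, f1, f2}" "h \<notin> {f0, f1, f2}"
        using x g h ae f1 f2 True by auto
      have "y \<notin> {a, b, e}" "z \<notin> {a, b, e}"
        using free[OF g(1) _ gh(1)] free[OF h(1) _ gh(2)] g h by auto
      then have "z = y"
        using five_elements[OF N, of a b e x y z] ae f1 be x g h by auto
      then have "g = h"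
        using inj_onD[OF inj, of g h] g h gh by auto
      then show ?thesis
        using h(2) by simp
    next
      case ce: False
      obtain f3 d where f3: "f3 \<in> F" "f3 \<noteq> f2" "d \<in> N" "d \<noteq> c" "nb f3 = {c, d}"
        using other[OF f2(3), of f2] by blast
      have f301: "f3 \<noteq> f0" "f3 \<noteq> f1"
        using f3 ae f1 f2 ce ca by auto
      have d: "d \<noteq> a" "d \<noteq> b"
        using used[OF f0 f1(1) f3(1), of a] used[OF f1(1) f2(1) f3(1), of b] ae f1 f2 f3 f301 by auto
      show ?thesis
      proof (cases "d = e")
        case True
        \<comment> \<open>A closed 4-cycle leaves one vertex, and the edge \<open>g\<close> at it
          would have to end in a vertex that already has two edges.\<close>
        have "\<not> N \<subseteq> {a, b, c, e}"
          using N card_mono[of "{a, b, c, e}" N] ae f1 f2 be ca ce by auto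
        then obtain x where x: "x \<in> N" "x \<notin> {a, b, c, e}"
          by blast
        obtain g y where g: "g \<in> F" "g \<noteq> f0" "y \<in> N" "y \<noteq> x" "nb g = {x, y}"
          using other[OF x(1), of f0] by blast
        have gn: "g \<noteq> f1" "g \<noteq> f2" "g \<noteq> f3"
          using x g f1 f2 f3 True by auto
        have "y \<in> {a, b, c, e, x}"
          using five_elements[OF N, of a b c e x y] ae f1 f2 be ca ce x g by auto
        then show ?thesis
          using used[OF f0 f1(1) g(1), of a] used[OF f1(1) f2(1) g(1), of b]
            used[OF f2(1) f3(1) g(1), of c] used[OF f0 f3(1) g(1), of e]
            ae f1 f2 f3 g gn f301 True by auto
      next
        case de: False
        obtain f4 z where f4: "f4 \<in> F" "f4 \<noteq> f3" "z \<in> N" "z \<noteq> d" "nb f4 = {d, z}"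
          using other[OF f3(3), of f3] by blast
        have f4n: "f4 \<noteq> f0" "f4 \<noteq> f1" "f4 \<noteq> f2"
          using f4 ae f1 f2 f3 d de by auto
        have "z \<noteq> a" "z \<noteq> b" "z \<noteq> c"
          using used[OF f0 f1(1) f4(1), of a] used[OF f1(1) f2(1) f4(1), of b]
            used[OF f2(1) f3(1) f4(1), of c] ae f1 f2 f3 f4 f4n by auto
        moreover have "z \<in> {a, b, c, d, e}"
          using five_elements[OF N, of a b c d e z] ae f1 f2 f3 f4 be ca ce d de by auto
        ultimately have "z = e"
          using f4 by auto
        have "nb ` {f1, f2, f3, f4} \<subseteq> nb ` (F - {f0})"
          using f1(1,2) f2(1) f20 f3(1) f301(1) f4(1) f4n(1) by (intro image_mono) auto
        then have "{{a, b}, {b, c}, {c, d}, {d, e}} \<subseteq> nb ` (F - {f0})"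
          using f1(5) f2(5) f3(5) f4(5) \<open>z = e\<close> by simp
        moreover have "distinct [a, b, c, d, e]"
          using ae(2) f1(4) f2(4) f3(4) be ca ce d de by auto
        ultimately show ?thesis
          using ae(1) by blast
      qed
    qed
  qed
qed

subsection \<open>Small models of the complete graph on four vertices\<close>

text \<open>Kept as a pair digraph, unlike \<open>with_proj G \<restriction> S\<close>, because
  \<open>complete_model\<close> takes branch sets of this type.\<close>

definition induced :: "'a pair_pre_digraph \<Rightarrow> 'a set \<Rightarrow> 'a pair_pre_digraph" where
  "induced G S = \<lparr>pverts = S, parcs = parcs G \<inter> S \<times> S\<rparr>"

lemma pverts_induced [simp]: "pverts (induced G S) = S"
  by (simp add: induced_def)

lemma parcs_induced [simp]: "parcs (induced G S) = parcs G \<inter> S \<times> S"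
  by (simp add: induced_def)

lemma edge_in_edges_iff:
  assumes "pair_graph G"
  shows "{u, v} \<in> edges G \<longleftrightarrow> (u, v) \<in> parcs G"
proof -
  interpret pair_graph G by fact
  show ?thesis
    using arcs_symmetric by (auto simp: edges_def doubleton_eq_iff)
qed

lemma pair_graph_induced:
  assumes "pair_graph G" "S \<subseteq> pverts G"
  shows "pair_graph (induced G S)"
proof -
  interpret pair_graph G by fact
  have "finite S"
    using assms(2) pair_finite_verts finite_subset by blast
  moreover have "symmetric (with_proj (induced G S))"
    using arcs_symmetric by (auto simp: symmetric_def intro: symI)
  ultimately show ?thesis
    using pair_finite_arcs no_loops' by unfold_locales auto
qed

lemma subgraph_induced:
  assumes "pair_graph G" "S \<subseteq> pverts G"
  shows "subgraph (with_proj (induced G S)) (with_proj G)"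
proof -
  interpret G: pair_graph G by fact
  interpret H: pair_graph "induced G S"
    using assms by (rule pair_graph_induced)
  show ?thesis
    using assms(2) G.wf_digraph_axioms H.wf_digraph_axioms by (auto simp: subgraph_def compatible_def)
qed

text \<open>The set \<open>S\<close> stays fixed while the list shrinks in the induction, so that
  all steps take place in the same induced graph.\<close>

lemma path_reachable:
  assumes G: "pair_graph G"
  shows "path_edges xs \<subseteq> edges G \<Longrightarrow> set xs \<subseteq> S \<Longrightarrow> u \<in> set xs \<Longrightarrow> v \<in> set xs \<Longrightarrow>
    (u, v) \<in> rtrancl_on S (parcs G \<inter> S \<times> S)"
proof (induction xs arbitrary: u v rule: path_edges.induct)
  case (3 x y zs)
  let ?r = "rtrancl_on S (parcs G \<inter> S \<times> S)"
  have IH: "(s, t) \<in> ?r" if "s \<in> set (y # zs)" "t \<in> set (y # zs)" for s t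
    using 3 that by auto
  have "(x, y) \<in> parcs G" "(y, x) \<in> parcs G"
    using 3(2) edge_in_edges_iff[OF G, of x y] edge_in_edges_iff[OF G, of y x]
    by (auto simp: insert_commute)
  then have xy: "(x, y) \<in> parcs G \<inter> S \<times> S" "(y, x) \<in> parcs G \<inter> S \<times> S"
    using 3(3) by auto
  have "(x, t) \<in> ?r" if "t \<in> set (y # zs)" for t
    using converse_rtrancl_on_into_rtrancl_on[OF xy(1) IH[of y t]] 3(3) that by auto
  moreover have "(s, x) \<in> ?r" if "s \<in> set (y # zs)" for s
    using rtrancl_on_into_rtrancl_on[OF IH[of s y] xy(2)] 3(3) that by auto
  moreover have "(x, x) \<in> ?r"
    using 3(3) by auto
  ultimately show ?case
    using 3(4,5) IH by (metis set_ConsD)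
qed auto

lemma connected_induced_path:
  assumes G: "pair_graph G" and xs: "xs \<noteq> []" "path_edges xs \<subseteq> edges G" "set xs \<subseteq> pverts G"
  shows "Digraph_Component.connected (with_proj (induced G (set xs)))"
proof -
  interpret H: pair_graph "induced G (set xs)"
    using G xs(3) by (rule pair_graph_induced)
  show ?thesis
  proof (rule H.connectedI)
    show "pverts (induced G (set xs)) \<noteq> {}"
      using xs(1) by simp
    fix u v assume "u \<in> pverts (induced G (set xs))" "v \<in> pverts (induced G (set xs))"
    then have "(u, v) \<in> rtrancl_on (set xs) (parcs G \<inter> set xs \<times> set xs)"
      using path_reachable[OF G xs(2) subset_refl] by simp
    then have "u \<rightarrow>\<^sup>*\<^bsub>with_proj (induced G (set xs))\<^esub> v"
      by (simp add: reachable_def)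
    then show "u \<rightarrow>\<^sup>*\<^bsub>with_proj (mk_symmetric (with_proj (induced G (set xs))))\<^esub> v"
      by (rule H.reachable_mk_symmetricI)
  qed
qed

text \<open>Of three segments in cyclic order any two are consecutive, so a rim edge joins them; the
  hub is the fourth branch set and sees the head of each segment.\<close>

lemma wheel_model:
  assumes G: "pair_graph G"
    and dist: "distinct (v # xs @ ys @ zs)" and ne: "xs \<noteq> []" "ys \<noteq> []" "zs \<noteq> []"
    and rim: "cycle_edges (xs @ ys @ zs) \<subseteq> edges G"
    and spokes: "{v, hd xs} \<in> edges G" "{v, hd ys} \<in> edges G" "{v, hd zs} \<in> edges G"
  shows "\<exists>B. complete_model 4 G B \<and> model_order 4 B = Suc (length (xs @ ys @ zs))"
proof -
  interpret pair_graph G by fact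
  obtain x xs' y ys' z zs' where split: "xs = x # xs'" "ys = y # ys'" "zs = z # zs'"
    using ne by (metis list.exhaust)
  have "cycle_edges (xs @ ys @ zs) = path_edges (xs @ y # ys' @ z # zs' @ [x])"
    by (simp add: cycle_edges_def split)
  also have "\<dots> = path_edges (xs @ [y]) \<union> (path_edges (ys @ [z]) \<union> path_edges (zs @ [x]))"
    using path_edges_append[of xs y "ys' @ z # zs' @ [x]"] path_edges_append[of ys z "zs' @ [x]"] split
    by (metis append_Cons append_assoc)
  finally have C: "cycle_edges (xs @ ys @ zs) =
      path_edges (xs @ [y]) \<union> (path_edges (ys @ [z]) \<union> path_edges (zs @ [x]))" .
  have path: "path_edges xs \<subseteq> edges G" "path_edges ys \<subseteq> edges G" "path_edges zs \<subseteq> edges G"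
    and link: "{last xs, y} \<in> edges G" "{last ys, z} \<in> edges G" "{last zs, x} \<in> edges G"
    using rim ne unfolding C by (simp_all add: path_edges_snoc)
  have V: "u \<in> pverts G" if "u \<in> e" "e \<in> edges G" for u e
    using that in_arcsD1 in_arcsD2 by (auto simp: edges_def)
  have "set (xs @ ys @ zs) = \<Union> (cycle_edges (xs @ ys @ zs))"
    using ne by (intro Union_cycle_edges[symmetric]) (auto simp: split)
  then have verts: "set xs \<subseteq> pverts G" "set ys \<subseteq> pverts G" "set zs \<subseteq> pverts G"
    using V rim by auto
  have v: "v \<in> pverts G"
    using V[OF _ spokes(1)] by simp
  define L where "L = (\<lambda>i. [[v], xs, ys, zs] ! i)"
  define B where "B = (\<lambda>i. induced G (set (L i)))"
  have L: "L 0 = [v]" "L 1 = xs" "L (Suc 0) = xs" "L 2 = ys" "L 3 = zs"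
    by (simp_all add: L_def numeral_eq_Suc)
  have four: "i < 4 \<longleftrightarrow> i = 0 \<or> i = 1 \<or> i = 2 \<or> i = (3::nat)" for i
    by auto
  have seg: "L i \<noteq> []" "path_edges (L i) \<subseteq> edges G" "set (L i) \<subseteq> pverts G" if "i < 4" for i
    using that ne path verts v unfolding four by (auto simp: L)
  have adj: "\<exists>s \<in> set (L i). \<exists>t \<in> set (L j). {s, t} \<in> edges G" if "i < 4" "j < 4" "i < j" for i j
  proof -
    have ends: "hd xs \<in> set xs" "last xs \<in> set xs" "hd ys \<in> set ys" "last ys \<in> set ys"
      "hd zs \<in> set zs" "last zs \<in> set zs"
      using ne by auto
    have *: "{last xs, hd ys} \<in> edges G" "{last ys, hd zs} \<in> edges G" "{hd xs, last zs} \<in> edges G"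
      using link by (auto simp: split insert_commute)
    have "\<exists>s \<in> set xs. \<exists>t \<in> set ys. {s, t} \<in> edges G" "\<exists>s \<in> set ys. \<exists>t \<in> set zs. {s, t} \<in> edges G"
      "\<exists>s \<in> set xs. \<exists>t \<in> set zs. {s, t} \<in> edges G"
      "\<exists>t \<in> set xs. {v, t} \<in> edges G" "\<exists>t \<in> set ys. {v, t} \<in> edges G" "\<exists>t \<in> set zs. {v, t} \<in> edges G"
      using ends * spokes by blast+
    moreover have "(i, j) \<in> {(0,1), (0,2), (0,3), (1,2), (1,3), (2,3)}"
      using that by auto
    ultimately show ?thesis
      by (elim insertE) (simp_all add: L)
  qed
  have "\<exists>s \<in> set (L i). \<exists>t \<in> set (L j). (s, t) \<in> parcs G" if "i < 4" "j < 4" "i \<noteq> j" for i j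
  proof (cases "i < j")
    case True
    then show ?thesis
      using adj[of i j] that edge_in_edges_iff[OF G] by blast
  next
    case False
    then show ?thesis
      using adj[of j i] that edge_in_edges_iff[OF G] by (metis insert_commute nat_neq_iff)
  qed
  moreover have "set (L i) \<inter> set (L j) = {}" if "i < 4" "j < 4" "i \<noteq> j" for i j
    using that dist unfolding four by (auto simp: L)
  ultimately have "complete_model 4 G B"
    unfolding complete_model_def B_def
    using pair_graph_induced[OF G] subgraph_induced[OF G] connected_induced_path[OF G] seg by simp
  moreover have "{..<4} = {0, 1, 2, 3::nat}"
    by auto
  then have "model_order 4 B = Suc (length (xs @ ys @ zs))"
    using dist by (simp add: model_order_def B_def L distinct_card)
  ultimately show ?thesis
    by blast
qed

section \<open>Short wheels around a light vertex\<close>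

text \<open>The rim is stored already cut, since the suitable cut varies from case to case. Only the
  heads of the segments need to be neighbours of the hub, and 7 is 8 less the hub.\<close>

definition short_wheel :: "'a set set \<Rightarrow> 'a \<Rightarrow> 'a list \<Rightarrow> 'a list \<Rightarrow> 'a list \<Rightarrow> bool" where
  "short_wheel E v xs ys zs \<longleftrightarrow> distinct (v # xs @ ys @ zs) \<and> xs \<noteq> [] \<and> ys \<noteq> [] \<and> zs \<noteq> [] \<and>
     cycle_edges (xs @ ys @ zs) \<subseteq> E \<and> {v, hd xs} \<in> E \<and> {v, hd ys} \<in> E \<and> {v, hd zs} \<in> E \<and>
     length (xs @ ys @ zs) \<le> 7"

text \<open>
  The detour from \<open>a\<close> to \<open>e\<close> may run through \<open>b\<close>, \<open>c\<close> or \<open>d\<close>; it then has chords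
  of the fan that close up a shorter rim.
\<close>

lemma fan_short_wheel:
  assumes spokes: "{v, a} \<in> E" "{v, b} \<in> E" "{v, c} \<in> E" "{v, d} \<in> E" "{v, e} \<in> E"
    and rim: "{a, b} \<in> E" "{b, c} \<in> E" "{c, d} \<in> E" "{d, e} \<in> E"
    and dist: "distinct [v, a, b, c, d, e]"
    and w: "distinct (v # a # w @ [e])" "path_edges (a # w @ [e]) \<subseteq> E" "length w \<le> 2"
  shows "\<exists>xs ys zs. short_wheel E v xs ys zs"
proof -
  note wheel = short_wheel_def cycle_edges_def insert_commute
  have wheelI: ?thesis if "short_wheel E v xs ys zs" for xs ys zs
    using that by blast
  consider "w = []" | s where "w = [s]" | s t where "w = [s, t]"
    using w(3) by (cases w rule: remdups_adj.cases) auto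
  then show ?thesis
  proof cases
    case 1
    then show ?thesis
      using assms by (intro wheelI[of "[a]" "[b]" "[c, d, e]"]) (auto simp: wheel)
  next
    case (2 s)
    then have s: "{a, s} \<in> E" "{s, e} \<in> E" "s \<notin> {v, a, e}"
      using w by auto
    consider "s = b" | "s = c" | "s = d" | "s \<notin> {b, c, d}"
      by blast
    then show ?thesis
    proof cases
      case 1
      then show ?thesis
        using s spokes rim dist by (intro wheelI[of "[b]" "[c]" "[d, e]"]) (auto simp: wheel)
    next
      case 2
      then show ?thesis
        using s spokes rim dist by (intro wheelI[of "[a]" "[b]" "[c]"]) (auto simp: wheel)
    next
      case 3
      then show ?thesis
        using s spokes rim dist by (intro wheelI[of "[a]" "[b]" "[c, d]"]) (auto simp: wheel)
    next
      case 4
      then show ?thesis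
        using s spokes rim dist by (intro wheelI[of "[a]" "[b]" "[c, d, e, s]"]) (auto simp: wheel)
    qed
  next
    case (3 s t)
    then have st: "{a, s} \<in> E" "{s, t} \<in> E" "{t, e} \<in> E" "s \<notin> {v, a, e}" "t \<notin> {v, a, e}" "s \<noteq> t"
      using w by auto
    \<comment> \<open>In the first five cases the detour provides a chord between vertices of the
      fan, which closes a rim inside the fan. In the last three, one or both of \<open>s\<close> and
      \<open>t\<close> are new and join the rim; only the last reaches length 7.\<close>
    consider "s = c" | "s = d" | "t = c" | "t = b" | "s = b" "t = d" | "s = b" "t \<notin> {b, c, d}"
      | "s \<notin> {b, c, d}" "t = d" | "s \<notin> {b, c, d}" "t \<notin> {b, c, d}"
      by blast
    then show ?thesis
    proof cases
      case 1
      then show ?thesis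
        using st spokes rim dist by (intro wheelI[of "[a]" "[b]" "[c]"]) (auto simp: wheel)
    next
      case 2
      then show ?thesis
        using st spokes rim dist by (intro wheelI[of "[a]" "[b]" "[c, d]"]) (auto simp: wheel)
    next
      case 3
      then show ?thesis
        using st spokes rim dist by (intro wheelI[of "[c]" "[d]" "[e]"]) (auto simp: wheel)
    next
      case 4
      then show ?thesis
        using st spokes rim dist by (intro wheelI[of "[b]" "[c]" "[d, e]"]) (auto simp: wheel)
    next
      case 5
      then show ?thesis
        using st spokes rim dist by (intro wheelI[of "[b]" "[c]" "[d]"]) (auto simp: wheel)
    next
      case 6
      then show ?thesis
        using st spokes rim dist by (intro wheelI[of "[b]" "[c]" "[d, e, t]"]) (auto simp: wheel)
    next
      case 7
      then show ?thesis
        using st spokes rim dist by (intro wheelI[of "[a]" "[b]" "[c, d, s]"]) (auto simp: wheel)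
    next
      case 8
      then show ?thesis
        using st spokes rim dist by (intro wheelI[of "[a]" "[b]" "[c, d, e, t, s]"]) (auto simp: wheel)
    qed
  qed
qed

text \<open>Each face \<open>f\<close> at the light vertex becomes the edge \<open>nb f\<close>
  between the two neighbours through which its boundary enters and leaves \<open>v\<close>. This
  multigraph is 2-regular because each spoke lies on two faces, and a triangular face makes
  \<open>nb f\<close> an edge of the graph.\<close>

lemma (in plane_graph) exists_short_wheel:
  assumes F: "face_system E F" and deg: "\<And>v. v \<in> \<Union>E \<Longrightarrow> 5 \<le> card {e \<in> E. v \<in> e}"
  shows "\<exists>v xs ys zs. short_wheel E v xs ys zs"
proof -
  obtain v f0 where v: "card {e \<in> E. v \<in> e} = 5"
    and f0: "f0 \<in> F" "v \<in> set (fst f0)" "length (fst f0) \<le> 5"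
    and tri: "\<And>g. g \<in> F \<Longrightarrow> v \<in> set (fst g) \<Longrightarrow> g \<noteq> f0 \<Longrightarrow> length (fst g) = 3"
    by (rule exists_light_vertex[OF F deg], assumption, rule that)
  define N where "N = {x. {v, x} \<in> E}"
  define S where "S = {f \<in> F. v \<in> set (fst f)}"
  define nb where "nb f = {x. {v, x} \<in> cycle_edges (fst f)}" for f :: "'a list \<times> complex set"
  have sub: "cycle_edges (fst f) \<subseteq> E" if "f \<in> F" for f
    using face_systemD(3)[OF F, of "fst f" "snd f"] that by auto
  have vN: "v \<notin> N"
    using card_edge[of "{v, v}"] by (auto simp: N_def)
  have face: "\<exists>ys. cycle_edges (v # ys) = cycle_edges (fst f) \<and> distinct (v # ys) \<and>
      length (v # ys) = length (fst f) \<and> 2 \<le> length ys \<and> nb f = {hd ys, last ys} \<and> hd ys \<noteq> last ys"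
    if "f \<in> S" for f
  proof -
    have "f \<in> F" "v \<in> set (fst f)"
      using that by (simp_all add: S_def)
    from edges_of_face_at[OF F this]
    obtain ys where ys: "cycle_edges (v # ys) = cycle_edges (fst f)" "distinct (v # ys)"
      "length (v # ys) = length (fst f)" "2 \<le> length ys"
      "{e \<in> cycle_edges (fst f). v \<in> e} = {{v, hd ys}, {v, last ys}}" "hd ys \<noteq> last ys" .
    have "x \<in> nb f \<longleftrightarrow> {v, x} \<in> {e \<in> cycle_edges (fst f). v \<in> e}" for x
      by (simp add: nb_def)
    then have "nb f = {hd ys, last ys}"
      unfolding ys(5) by (auto simp: doubleton_eq_iff)
    then show ?thesis
      using ys by blast
  qed
  have N: "card N = 5"
  proof -
    have "(\<lambda>x. {v, x}) ` N = {e \<in> E. v \<in> e}"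
    proof
      show "{e \<in> E. v \<in> e} \<subseteq> (\<lambda>x. {v, x}) ` N"
      proof
        fix e assume e: "e \<in> {e \<in> E. v \<in> e}"
        then obtain x where "e = {v, x}"
          using card_edge[of e] by (auto simp: card_2_iff)
        then show "e \<in> (\<lambda>x. {v, x}) ` N"
          using e by (auto simp: N_def)
      qed
    qed (auto simp: N_def)
    moreover have "inj_on (\<lambda>x. {v, x}) N"
      by (auto simp: inj_on_def doubleton_eq_iff)
    ultimately show ?thesis
      using card_image v by metis
  qed
  have nb2: "card (nb f) = 2 \<and> nb f \<subseteq> N" if "f \<in> S" for f
  proof -
    have "nb f \<subseteq> N"
      using sub[of f] that by (auto simp: nb_def N_def S_def)
    then show ?thesis
      using face[OF that] by auto
  qed
  have two: "card {f \<in> S. x \<in> nb f} = 2" if "x \<in> N" for x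
  proof -
    have "{f \<in> S. x \<in> nb f} = {f \<in> F. {v, x} \<in> cycle_edges (fst f)}"
      using vertex_of_face_edge[OF F] by (auto simp: S_def nb_def)
    then show ?thesis
      using face_systemD(6)[OF F, of "{v, x}"] that by (simp add: N_def)
  qed
  have triangle: "cycle_edges (fst g) = insert (nb g) ((\<lambda>x. {v, x}) ` nb g)" if g: "g \<in> S - {f0}" for g
  proof -
    obtain ys where ys: "cycle_edges (v # ys) = cycle_edges (fst g)"
      "length (v # ys) = length (fst g)" "nb g = {hd ys, last ys}"
      using face[of g] g by blast
    have "length ys = 2"
      using tri[of g] ys(2) g by (simp add: S_def)
    then obtain s t where "ys = [s, t]"
      by (auto simp: length_Suc_conv numeral_2_eq_2)
    then show ?thesis
      using ys by (auto simp: cycle_edges_def)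
  qed
  have link: "nb ` (S - {f0}) \<subseteq> E"
    using triangle sub by (fastforce simp: S_def)
  \<comment> \<open>Triangles at \<open>v\<close> with the same third edge have the same boundary,
    so the whole graph would be that triangle and \<open>v\<close> would have degree 2 instead of
    5.\<close>
  have inj: "inj_on nb (S - {f0})"
  proof (rule inj_onI, rule ccontr)
    fix g h assume gh: "g \<in> S - {f0}" "h \<in> S - {f0}" "nb g = nb h" "g \<noteq> h"
    then have "cycle_edges (fst g) = cycle_edges (fst h)"
      using triangle by metis
    then have "E = cycle_edges (fst g)"
      using gh by (intro face_system_inj[OF F subset_refl]) (auto simp: S_def)
    then show False
      using card_edges_of_face_at[OF F, of g v] gh v by (simp add: S_def)
  qed
  have nbN: "\<Union>(nb ` (S - {f0})) \<subseteq> N"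
    using nb2 by auto
  have "f0 \<in> S"
    using f0 by (simp add: S_def)
  have "(\<exists>x y z. distinct [x, y, z] \<and> {{x, y}, {y, z}, {x, z}} \<subseteq> nb ` (S - {f0})) \<or>
    (\<exists>a b c d e. distinct [a, b, c, d, e] \<and> nb f0 = {a, e} \<and>
       {{a, b}, {b, c}, {c, d}, {d, e}} \<subseteq> nb ` (S - {f0}))"
    by (rule two_regular_on_five[OF N nb2 two \<open>f0 \<in> S\<close> inj])
  then show ?thesis
  proof (elim disjE exE conjE)
    fix x y z
    assume 1: "distinct [x, y, z]" "{{x, y}, {y, z}, {x, z}} \<subseteq> nb ` (S - {f0})"
    have "{x, y, z} \<subseteq> N"
      using order.trans[OF Union_mono[OF 1(2)] nbN] by simp
    moreover have "{x, y} \<in> E" "{y, z} \<in> E" "{x, z} \<in> E"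
      using order.trans[OF 1(2) link] by simp_all
    \<comment> \<open>Three pairwise adjacent neighbours of \<open>v\<close> already form a K4 with
      it.\<close>
    ultimately have "short_wheel E v [x] [y] [z]"
      using 1(1) vN by (auto simp: short_wheel_def cycle_edges_def N_def insert_commute)
    then show ?thesis
      by blast
  next
    fix a b c d e
    assume 2: "distinct [a, b, c, d, e]" "nb f0 = {a, e}"
      "{{a, b}, {b, c}, {c, d}, {d, e}} \<subseteq> nb ` (S - {f0})"
    have abc: "{a, b, c, d, e} \<subseteq> N"
      using order.trans[OF Union_mono[OF 2(3)] nbN] by simp
    have rim: "{a, b} \<in> E" "{b, c} \<in> E" "{c, d} \<in> E" "{d, e} \<in> E"
      using order.trans[OF 2(3) link] by simp_all
    obtain ys where ys: "cycle_edges (v # ys) = cycle_edges (fst f0)" "distinct (v # ys)"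
      "length (v # ys) = length (fst f0)" "2 \<le> length ys" "nb f0 = {hd ys, last ys}"
      using face[OF \<open>f0 \<in> S\<close>] by blast
    obtain s ys' where "ys = s # ys'"
      using ys(4) by (cases ys) auto
    then obtain w t where yw: "ys = s # w @ [t]"
      using ys(4) by (cases ys' rule: rev_cases) auto
    have "path_edges ys \<subseteq> cycle_edges (v # ys)"
      unfolding cycle_edges_def yw by (auto simp: path_edges_snoc[of "s # w @ [t]" v, simplified])
    then have pe: "path_edges (s # w @ [t]) \<subseteq> E"
      using ys(1) sub[OF f0(1)] yw by simp
    \<comment> \<open>The boundary of \<open>f0\<close> consists of \<open>v\<close>,
      \<open>s\<close>, \<open>w\<close> and \<open>t\<close> and has length at most 5.\<close>
    have len: "length w \<le> 2"
      using ys(3) f0(3) yw by simp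
    obtain w' where w': "distinct (v # a # w' @ [e])" "path_edges (a # w' @ [e]) \<subseteq> E" "length w' \<le> 2"
    proof (cases "s = a")
      case True
      then have "t = e"
        using ys(5) 2(2) yw by (auto simp: doubleton_eq_iff)
      then show ?thesis
        using that[of w] ys(2) yw pe len True by simp
    next
      case False
      then have "s = e" "t = a"
        using ys(5) 2(2) yw by (auto simp: doubleton_eq_iff)
      then show ?thesis
        using that[of "rev w"] ys(2) yw pe len path_edges_rev[of "s # w @ [t]"] by auto
    qed
    have "distinct [v, a, b, c, d, e]"
      using 2(1) abc vN by auto
    moreover have "{v, a} \<in> E" "{v, b} \<in> E" "{v, c} \<in> E" "{v, d} \<in> E" "{v, e} \<in> E"
      using abc by (auto simp: N_def)
    ultimately show ?thesis
      using fan_short_wheel[OF _ _ _ _ _ rim _ w'] by blast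
  qed
qed

section \<open>From symmetric digraphs to sets of undirected edges\<close>

lemma card_edges_at:
  assumes G: "pair_graph G"
  shows "card {e \<in> edges G. v \<in> e} = out_degree (with_proj G) v"
proof -
  interpret pair_graph G by fact
  have "(\<lambda>(s, t). {s, t}) ` out_arcs (with_proj G) v = {e \<in> edges G. v \<in> e}"
  proof
    show "{e \<in> edges G. v \<in> e} \<subseteq> (\<lambda>(s, t). {s, t}) ` out_arcs (with_proj G) v"
    proof
      fix e assume "e \<in> {e \<in> edges G. v \<in> e}"
      then obtain x where "e = {v, x}" "e \<in> edges G"
        by (auto simp: edges_def)
      then show "e \<in> (\<lambda>(s, t). {s, t}) ` out_arcs (with_proj G) v"
        using edge_in_edges_iff[OF G, of v x] by (auto intro!: rev_image_eqI[of "(v, x)"])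
    qed
  qed (auto simp: edge_in_edges_iff[OF G])
  moreover have "card ((\<lambda>(s, t). {s, t}) ` out_arcs (with_proj G) v) = card (out_arcs (with_proj G) v)"
    by (rule card_image) (auto simp: inj_on_def doubleton_eq_iff)
  ultimately show ?thesis
    by (simp add: out_degree_def)
qed

text \<open>Connectedness is reachability in the symmetric closure. As \<open>G\<close> is
  symmetric, the closure of the restriction adds no arc beyond the edges of \<open>G\<close> inside
  \<open>S\<close>.\<close>

lemma connected_induce_subgraph_reachable:
  assumes G: "pair_graph G"
    and S: "Digraph_Component.connected (with_proj G \<restriction> S)" "u \<in> S" "w \<in> S"
  shows "(u, w) \<in> {(s, t). {s, t} \<in> edges G \<and> s \<in> S \<and> t \<in> S}\<^sup>*"
proof -
  interpret pair_graph G by fact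
  have "u \<rightarrow>\<^sup>*\<^bsub>with_proj (mk_symmetric (with_proj G \<restriction> S))\<^esub> w"
    using S by (simp add: Digraph_Component.connected_def strongly_connected_def)
  then have "(u, w) \<in> (parcs (mk_symmetric (with_proj G \<restriction> S)))\<^sup>*"
    unfolding reachable_def with_proj_simps by (rule rtrancl_on_rtranclI)
  moreover have "parcs (mk_symmetric (with_proj G \<restriction> S)) \<subseteq> {(s, t). {s, t} \<in> edges G \<and> s \<in> S \<and> t \<in> S}"
    by (auto simp: parcs_mk_symmetric edge_in_edges_iff[OF G] arcs_symmetric)
  ultimately show ?thesis
    by (rule rev_subsetD[OF _ rtrancl_mono])
qed

theorem theorem5p5:
  fixes G :: "'a pair_pre_digraph"
  assumes "pair_graph G"
    and "k_connected 3 G"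
    and "planar G"
    and "min_degree G = 5"
  shows "\<exists>B. complete_model 4 G B \<and> model_order 4 B \<le> 8"
proof -
  interpret pair_graph G by fact
  have deg: "5 \<le> card {e \<in> edges G. v \<in> e}" if "v \<in> pverts G" for v
  proof -
    have "Min (out_degree (with_proj G) ` pverts G) \<le> out_degree (with_proj G) v"
      using pair_finite_verts that by (intro Min_le finite_imageI imageI)
    then show ?thesis
      using assms(4) card_edges_at[OF assms(1), of v] unfolding min_degree_def by linarith
  qed
  \<comment> \<open>By the degree bound no vertex is isolated, so passing to the edge set loses no
    vertex.\<close>
  have V: "\<Union>(edges G) = pverts G"
  proof
    show "\<Union>(edges G) \<subseteq> pverts G"
      using in_arcsD1 in_arcsD2 by (auto simp: edges_def)
    show "pverts G \<subseteq> \<Union>(edges G)"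
    proof
      fix v assume "v \<in> pverts G"
      then have "{e \<in> edges G. v \<in> e} \<noteq> {}"
        using deg[of v] by (metis card.empty not_numeral_le_zero)
      then show "v \<in> \<Union>(edges G)"
        by blast
    qed
  qed
  obtain p \<gamma> where emb: "plane_embedding G p \<gamma>"
    using assms(3) by (auto simp: planar_def)
  interpret two_connected_plane_graph "edges G" p \<gamma>
  proof
    show "finite (edges G)"
      by (rule finite_subset[OF _ finite_imageI[OF pair_finite_arcs, of "\<lambda>(u, v). {u, v}"]])
        (force simp: edges_def)
    show "card e = 2" if e: "e \<in> edges G" for e
    proof -
      obtain u w where "e = {u, w}" "(u, w) \<in> parcs G"
        using e unfolding edges_def by blast
      then show ?thesis
        using no_loops'[of u w] by simp
    qed
    show "inj_on p (\<Union>(edges G))"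
      using emb by (simp add: plane_embedding_def V)
    fix e assume e: "e \<in> edges G"
    show "Path_Connected.arc (\<gamma> e)" "{pathstart (\<gamma> e), pathfinish (\<gamma> e)} = p ` e"
      "path_image (\<gamma> e) \<inter> p ` \<Union>(edges G) = p ` e"
      using emb e by (simp_all add: plane_embedding_def V)
    fix f assume "f \<in> edges G" "e \<noteq> f"
    then show "path_image (\<gamma> e) \<inter> path_image (\<gamma> f) \<subseteq> p ` (e \<inter> f)"
      using emb e by (simp add: plane_embedding_def)
  next
    fix u w x
    assume uw: "u \<in> \<Union>(edges G)" "w \<in> \<Union>(edges G)" "u \<noteq> x" "w \<noteq> x"
    \<comment> \<open>\<open>k_connected\<close> speaks about sets of vertices, while
      \<open>x\<close> is arbitrary; hence the deleted set is
      \<open>{x} \<inter> pverts G\<close>.\<close>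
    let ?S = "pverts G - {x} \<inter> pverts G"
    have "card ({x} \<inter> pverts G) < 3"
      using card_mono[of "{x}" "{x} \<inter> pverts G"] by auto
    then have "Digraph_Component.connected (with_proj G \<restriction> ?S)"
      using assms(2) by (simp add: k_connected_def)
    then have "(u, w) \<in> {(s, t). {s, t} \<in> edges G \<and> s \<in> ?S \<and> t \<in> ?S}\<^sup>*"
      using uw V by (intro connected_induce_subgraph_reachable assms(1)) auto
    moreover have "{(s, t). {s, t} \<in> edges G \<and> s \<in> ?S \<and> t \<in> ?S} \<subseteq>
        {(s, t). {s, t} \<in> edges G \<and> s \<noteq> x \<and> t \<noteq> x}"
      by auto
    ultimately show "(u, w) \<in> {(s, t). {s, t} \<in> edges G \<and> s \<noteq> x \<and> t \<noteq> x}\<^sup>*"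
      by (rule rev_subsetD[OF _ rtrancl_mono])
  qed
  have "2 < card (\<Union>(edges G))"
    using assms(2) by (simp add: V k_connected_def)
  then obtain F where "face_system (edges G) F"
    using exists_face_system by blast
  then have "\<exists>v xs ys zs. short_wheel (edges G) v xs ys zs"
    by (rule exists_short_wheel) (use deg V in simp)
  then obtain v xs ys zs where wheel: "short_wheel (edges G) v xs ys zs"
    by (elim exE)
  then have "\<exists>B. complete_model 4 G B \<and> model_order 4 B = Suc (length (xs @ ys @ zs))"
    unfolding short_wheel_def by (elim conjE) (rule wheel_model[OF assms(1)])
  then obtain B where "complete_model 4 G B" "model_order 4 B = Suc (length (xs @ ys @ zs))"
    by blast
  moreover have "length (xs @ ys @ zs) \<le> 7"
    using wheel unfolding short_wheel_def by (elim conjE)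
  ultimately have "complete_model 4 G B \<and> model_order 4 B \<le> 8"
    by linarith
  then show ?thesis
    by blast
qed

end
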